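(* Let $E\to B$ be a real vector bundle of rank $m$ over a Riemannian $n$-manifold, equipped with a fibre metric and compatible connection, and let $g=h^2\big(\sum_{i=1}^nb_i^2\big)+k^2\big(\sum_{\alpha=1}^m\zeta_\alpha^2\big)$ be the metric on the total space of $E$ determined by smooth positive functions $h,k$ of the fibre radius $r$. Let $s=s(r)$ be a smooth function of $r$. Then its Laplacian $\Delta s=g^{pq}\nabla_p\nabla_qs$ with respect to $g$ is $$\Delta s=\frac{1}{k^2}s''+\left(\frac{m-1}{k^2r}+\frac{nh'}{hk^2}+\frac{(m-2)k'}{k^3}\right)s'.$$
   Context: Let $\pi:E\to B$ be a real vector bundle of rank $m$ over an $n$-manifold $B$ with Riemannian metric $\check g$; $E$ has a fibre metric and a compatible connection, so $TE$ splits into horizontal and vertical subbundles. Locally, $\{b_i\}_{i=1}^n$ is a $\check g$-orthonormal coframe on $B$, pulled back to $E$; $x_\alpha$ are the fibre coordinates on $E$ of a local orthonormal frame $\{\sigma_\alpha\}_{\alpha=1}^m$ of $E$; and $\zeta_\alpha=dx_\alpha+x_\beta\omega_{\alpha\beta}$ are the vertical 1-forms annihilating the horizontal distribution, with $\omega_{\alpha\beta}=-\omega_{\beta\alpha}$ (connection) 1-forms pulled back from $B$. The fibre radius is $r$, $r^2=\sum_\alpha x_\alpha^2$. The functions $h,k$ are smooth positive functions of $r\in[0,\infty)$; $g$ does not depend on the choices of frames. $\nabla$ is the Levi-Civita connection of $g$, and prime denotes $d/dr$. Formulas are understood where $r>0$. *)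

theory Defs
  imports "HOL-Analysis.Analysis"
begin

section \<open>Smooth functions\<close>

text \<open>\<open>Ck_on k S f\<close> is meant for open \<open>S\<close> in a finite-dimensional space: all iterated
  directional derivatives of order at most \<open>k\<close> exist and are continuous on \<open>S\<close>.\<close>

primrec Ck_on :: "nat \<Rightarrow> 'a::real_normed_vector set \<Rightarrow> ('a \<Rightarrow> 'b::real_normed_vector) \<Rightarrow> bool" where
  "Ck_on 0 S f \<longleftrightarrow> continuous_on S f"
| "Ck_on (Suc k) S f \<longleftrightarrow> (\<forall>x\<in>S. f differentiable (at x)) \<and>
     (\<forall>v. Ck_on k S (\<lambda>x. frechet_derivative f (at x) v))"

text \<open>On a set that need not be open (here only \<open>{0..}\<close>), smooth means: restriction of a smooth
  function on an open set.\<close>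

definition smooth_on :: "'a::real_normed_vector set \<Rightarrow> ('a \<Rightarrow> 'b::real_normed_vector) \<Rightarrow> bool" where
  "smooth_on S f \<longleftrightarrow>
     (\<exists>T F. open T \<and> S \<subseteq> T \<and> (\<forall>x\<in>S. F x = f x) \<and> (\<forall>k. Ck_on k T F))"

section \<open>Manifolds\<close>

text \<open>A chart is a pair of its domain and its coordinate map, which is only relevant on the domain.\<close>

type_synonym ('a, 'n) chart = "'a set \<times> ('a \<Rightarrow> real^'n)"

definition chart_inv :: "('a, 'n) chart \<Rightarrow> real^'n \<Rightarrow> 'a" where
  "chart_inv c = inv_into (fst c) (snd c)"

definition is_chart :: "('a::topological_space, 'n::finite) chart \<Rightarrow> bool" where
  "is_chart c \<longleftrightarrow> open (fst c) \<and> open (snd c ` fst c) \<and>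
     homeomorphism (fst c) (snd c ` fst c) (snd c) (chart_inv c)"

definition smooth_map :: "('a, 'n::finite) chart set \<Rightarrow> 'a set \<Rightarrow> ('a \<Rightarrow> 'c::real_normed_vector) \<Rightarrow> bool" where
  "smooth_map A U f \<longleftrightarrow> (\<forall>c\<in>A. smooth_on (snd c ` (U \<inter> fst c)) (f \<circ> chart_inv c))"

definition smooth_atlas :: "('a::topological_space, 'n::finite) chart set \<Rightarrow> bool" where
  "smooth_atlas A \<longleftrightarrow> (\<forall>c\<in>A. is_chart c) \<and> (\<Union>c\<in>A. fst c) = UNIV \<and>
     (\<forall>d\<in>A. smooth_map A (fst d) (snd d))"

text \<open>A tangent vector at \<open>p\<close> is given by its components \<open>u\<close> in a chart \<open>c\<close>. \<open>chart_deriv c f p u\<close> is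
  the derivative \<open>df\<close> at \<open>p\<close> applied to it. In particular \<open>chart_deriv c (snd d) p u\<close> are the
  components of the same tangent vector in another chart \<open>d\<close>; geometric objects are given by
  their components in all charts of the atlas, subject to the corresponding transformation law.\<close>

definition chart_deriv ::
  "('a, 'n::finite) chart \<Rightarrow> ('a \<Rightarrow> 'c::real_normed_vector) \<Rightarrow> 'a \<Rightarrow> real^'n \<Rightarrow> 'c" where
  "chart_deriv c f p u = frechet_derivative (f \<circ> chart_inv c) (at (snd c p)) u"

definition one_form_on ::
  "('a, 'n::finite) chart set \<Rightarrow> 'a set \<Rightarrow> (('a, 'n) chart \<Rightarrow> 'a \<Rightarrow> real^'n) \<Rightarrow> bool" where
  "one_form_on A U \<theta> \<longleftrightarrow>
     (\<forall>c\<in>A. smooth_on (snd c ` (U \<inter> fst c)) (\<theta> c \<circ> chart_inv c)) \<and>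
     (\<forall>c\<in>A. \<forall>d\<in>A. \<forall>p \<in> U \<inter> fst c \<inter> fst d. \<forall>u. \<theta> c p \<bullet> u = \<theta> d p \<bullet> chart_deriv c (snd d) p u)"

type_synonym ('a, 'n) metric = "('a, 'n) chart \<Rightarrow> 'a \<Rightarrow> real^'n^'n"

definition riemannian_metric_on ::
  "('a, 'n::finite) chart set \<Rightarrow> 'a set \<Rightarrow> ('a, 'n) metric \<Rightarrow> bool" where
  "riemannian_metric_on A W g \<longleftrightarrow>
     (\<forall>c\<in>A. smooth_on (snd c ` (W \<inter> fst c)) (g c \<circ> chart_inv c)) \<and>
     (\<forall>c\<in>A. \<forall>p \<in> W \<inter> fst c.
        transpose (g c p) = g c p \<and> (\<forall>u. u \<noteq> 0 \<longrightarrow> u \<bullet> (g c p *v u) > 0)) \<and>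
     (\<forall>c\<in>A. \<forall>d\<in>A. \<forall>p \<in> W \<inter> fst c \<inter> fst d. \<forall>u v.
        u \<bullet> (g c p *v v) = chart_deriv c (snd d) p u \<bullet> (g d p *v chart_deriv c (snd d) p v))"

text \<open>An affine connection is given by its Christoffel symbols, as a vector-valued bilinear map:
  \<open>\<Gamma> c p u v\<close> has components \<open>\<Gamma>\<^sup>l\<^sub>p\<^sub>q u\<^sup>p v\<^sup>q\<close>, so that
  \<open>(\<nabla>\<^sub>u Y) = \<partial>\<^sub>u Y + \<Gamma>(u, Y)\<close> in the chart \<open>c\<close>.\<close>

type_synonym ('a, 'n) christoffel = "('a, 'n) chart \<Rightarrow> 'a \<Rightarrow> real^'n \<Rightarrow> real^'n \<Rightarrow> real^'n"

definition affine_connection_on ::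
  "('a, 'n::finite) chart set \<Rightarrow> 'a set \<Rightarrow> ('a, 'n) christoffel \<Rightarrow> bool" where
  "affine_connection_on A W \<Gamma> \<longleftrightarrow>
     (\<forall>c\<in>A. \<forall>p \<in> W \<inter> fst c. bilinear (\<Gamma> c p)) \<and>
     (\<forall>c\<in>A. \<forall>u v. smooth_on (snd c ` (W \<inter> fst c)) ((\<lambda>p. \<Gamma> c p u v) \<circ> chart_inv c)) \<and>
     (\<forall>c\<in>A. \<forall>d\<in>A. \<forall>p \<in> W \<inter> fst c \<inter> fst d. \<forall>u v.
        chart_deriv c (snd d) p (\<Gamma> c p u v) =
          \<Gamma> d p (chart_deriv c (snd d) p u) (chart_deriv c (snd d) p v) +
          chart_deriv c (\<lambda>q. chart_deriv c (snd d) q v) p u)"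

definition levi_civita_on ::
  "('a, 'n::finite) chart set \<Rightarrow> 'a set \<Rightarrow> ('a, 'n) metric \<Rightarrow> ('a, 'n) christoffel \<Rightarrow> bool" where
  "levi_civita_on A W g \<Gamma> \<longleftrightarrow> affine_connection_on A W \<Gamma> \<and>
     (\<forall>c\<in>A. \<forall>p \<in> W \<inter> fst c. \<forall>u v. \<Gamma> c p u v = \<Gamma> c p v u) \<and>
     (\<forall>c\<in>A. \<forall>p \<in> W \<inter> fst c. \<forall>u v w.
        chart_deriv c (\<lambda>q. v \<bullet> (g c q *v w)) p u =
          \<Gamma> c p u v \<bullet> (g c p *v w) + v \<bullet> (g c p *v \<Gamma> c p u w))"

text \<open>\<open>(\<nabla>\<^sub>u \<theta>)(v) = \<partial>\<^sub>u (\<theta>(v)) - \<theta>(\<Gamma>(u, v))\<close> for a 1-form \<open>\<theta>\<close> and constant components \<open>v\<close>.\<close>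

definition cov_deriv_form ::
  "('a, 'n::finite) christoffel \<Rightarrow> ('a, 'n) chart \<Rightarrow> ('a \<Rightarrow> real^'n \<Rightarrow> real) \<Rightarrow> 'a \<Rightarrow> real^'n \<Rightarrow> real^'n \<Rightarrow> real" where
  "cov_deriv_form \<Gamma> c \<theta> p u v = chart_deriv c (\<lambda>q. \<theta> q v) p u - \<theta> p (\<Gamma> c p u v)"

definition hessian ::
  "('a, 'n::finite) christoffel \<Rightarrow> ('a, 'n) chart \<Rightarrow> ('a \<Rightarrow> real) \<Rightarrow> 'a \<Rightarrow> real^'n \<Rightarrow> real^'n \<Rightarrow> real" where
  "hessian \<Gamma> c f = cov_deriv_form \<Gamma> c (chart_deriv c f)"

text \<open>\<open>g\<^sup>p\<^sup>q \<nabla>\<^sub>p \<nabla>\<^sub>q f\<close>, computed in the chart \<open>c\<close>.\<close>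

definition laplacian ::
  "('a, 'n::finite) metric \<Rightarrow> ('a, 'n) christoffel \<Rightarrow> ('a, 'n) chart \<Rightarrow> ('a \<Rightarrow> real) \<Rightarrow> 'a \<Rightarrow> real" where
  "laplacian g \<Gamma> c f x = (\<Sum>p\<in>UNIV. \<Sum>q\<in>UNIV.
     matrix_inv (g c x) $ p $ q * hessian \<Gamma> c f x (axis p 1) (axis q 1))"

section \<open>Vector bundles\<close>

text \<open>\<open>vadd\<close> and \<open>vscale\<close> are the vector space operations of the fibres (\<open>vadd\<close> is relevant only on
  pairs in the same fibre). A local trivialisation over \<open>U\<close> is recorded by its \<open>real^'m\<close>-valued
  component, relevant only on the preimage of \<open>U\<close>.\<close>

record ('b, 'e, 'm) vbundle =
  proj :: "'e \<Rightarrow> 'b"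
  vadd :: "'e \<Rightarrow> 'e \<Rightarrow> 'e"
  vscale :: "real \<Rightarrow> 'e \<Rightarrow> 'e"
  trivs :: "('b set \<times> ('e \<Rightarrow> real^'m)) set"

definition vector_bundle ::
  "('b::topological_space, 'n::finite) chart set \<Rightarrow> ('b, 'e::topological_space, 'm::finite) vbundle \<Rightarrow> bool" where
  "vector_bundle A E \<longleftrightarrow>
     continuous_on UNIV (proj E) \<and>
     (\<forall>e e'. proj E e = proj E e' \<longrightarrow> proj E (vadd E e e') = proj E e) \<and>
     (\<forall>a e. proj E (vscale E a e) = proj E e) \<and>
     (\<Union>t\<in>trivs E. fst t) = UNIV \<and>
     (\<forall>t\<in>trivs E. open (fst t) \<and>
        (\<exists>\<Psi>. homeomorphism (proj E -` fst t) (fst t \<times> UNIV) (\<lambda>e. (proj E e, snd t e)) \<Psi>) \<and>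
        (\<forall>e \<in> proj E -` fst t. \<forall>e'. proj E e = proj E e' \<longrightarrow>
           snd t (vadd E e e') = snd t e + snd t e') \<and>
        (\<forall>e \<in> proj E -` fst t. \<forall>a. snd t (vscale E a e) = a *\<^sub>R snd t e)) \<and>
     (\<forall>t\<in>trivs E. \<forall>t'\<in>trivs E. \<exists>M :: 'b \<Rightarrow> real^'m^'m.
        smooth_map A (fst t \<inter> fst t') M \<and>
        (\<forall>e \<in> proj E -` (fst t \<inter> fst t'). snd t' e = M (proj E e) *v snd t e))"

text \<open>The charts of the total space have coordinates indexed by the disjoint sum of the index types.\<close>

definition bundle_chart ::
  "('b, 'e, 'm::finite) vbundle \<Rightarrow> ('b, 'n::finite) chart \<Rightarrow> 'b set \<times> ('e \<Rightarrow> real^'m) \<Rightarrow> ('e, 'n + 'm) chart" where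
  "bundle_chart E c t =
     (proj E -` (fst c \<inter> fst t),
      \<lambda>e. \<chi> p. case p of Inl i \<Rightarrow> snd c (proj E e) $ i | Inr \<alpha> \<Rightarrow> snd t e $ \<alpha>)"

definition total_atlas ::
  "('b, 'n::finite) chart set \<Rightarrow> ('b, 'e, 'm::finite) vbundle \<Rightarrow> ('e, 'n + 'm) chart set" where
  "total_atlas A E = {bundle_chart E c t | c t. c \<in> A \<and> t \<in> trivs E}"

definition smooth_section ::
  "('b, 'n::finite) chart set \<Rightarrow> ('b, 'e, 'm::finite) vbundle \<Rightarrow> 'b set \<Rightarrow> ('b \<Rightarrow> 'e) \<Rightarrow> bool" where
  "smooth_section A E U \<sigma> \<longleftrightarrow> (\<forall>b\<in>U. proj E (\<sigma> b) = b) \<and>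
     (\<forall>t\<in>trivs E. smooth_map A (U \<inter> fst t) (snd t \<circ> \<sigma>))"

text \<open>A fibre metric \<open>G\<close> is relevant only on pairs in the same fibre; \<open>vscale E 0 e\<close> is the zero
  vector of the fibre of \<open>e\<close>.\<close>

definition fibre_metric ::
  "('b::topological_space, 'n::finite) chart set \<Rightarrow> ('b, 'e, 'm::finite) vbundle \<Rightarrow> ('e \<Rightarrow> 'e \<Rightarrow> real) \<Rightarrow> bool" where
  "fibre_metric A E G \<longleftrightarrow>
     (\<forall>e e'. proj E e = proj E e' \<longrightarrow> G e e' = G e' e) \<and>
     (\<forall>e e' e''. proj E e = proj E e'' \<and> proj E e' = proj E e'' \<longrightarrow>
        G (vadd E e e') e'' = G e e'' + G e' e'') \<and>
     (\<forall>a e e'. proj E e = proj E e' \<longrightarrow> G (vscale E a e) e' = a * G e e') \<and>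
     (\<forall>e. e \<noteq> vscale E 0 e \<longrightarrow> G e e > 0) \<and>
     (\<forall>U \<sigma> \<tau>. open U \<and> smooth_section A E U \<sigma> \<and> smooth_section A E U \<tau> \<longrightarrow>
        smooth_map A U (\<lambda>b. G (\<sigma> b) (\<tau> b)))"

definition fibre_radius :: "('e \<Rightarrow> 'e \<Rightarrow> real) \<Rightarrow> 'e \<Rightarrow> real" where
  "fibre_radius G e = sqrt (G e e)"

text \<open>A connection as a covariant derivative: \<open>D c b u \<sigma>\<close> is \<open>\<nabla>\<^sub>v \<sigma>\<close> at \<open>b\<close>, where \<open>v\<close> is the tangent
  vector at \<open>b\<close> with components \<open>u\<close> in the chart \<open>c\<close> and \<open>\<sigma>\<close> is any section that is smooth near \<open>b\<close>.
  It acts on germs of sections, as the covariant derivative of local sections does.\<close>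

type_synonym ('b, 'n, 'e) connection = "('b, 'n) chart \<Rightarrow> 'b \<Rightarrow> real^'n \<Rightarrow> ('b \<Rightarrow> 'e) \<Rightarrow> 'e"

definition bundle_connection ::
  "('b::topological_space, 'n::finite) chart set \<Rightarrow> ('b, 'e, 'm::finite) vbundle \<Rightarrow> ('b, 'n, 'e) connection \<Rightarrow> bool" where
  "bundle_connection A E D \<longleftrightarrow>
     (\<forall>U \<sigma>. open U \<and> smooth_section A E U \<sigma> \<longrightarrow>
        (\<forall>c\<in>A. \<forall>u. smooth_section A E (U \<inter> fst c) (\<lambda>b. D c b u \<sigma>)) \<and>
        (\<forall>c\<in>A. \<forall>b \<in> U \<inter> fst c.
           (\<forall>u v. D c b (u + v) \<sigma> = vadd E (D c b u \<sigma>) (D c b v \<sigma>)) \<and>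
           (\<forall>a u. D c b (a *\<^sub>R u) \<sigma> = vscale E a (D c b u \<sigma>)) \<and>
           (\<forall>d\<in>A. b \<in> fst d \<longrightarrow> (\<forall>u. D d b (chart_deriv c (snd d) b u) \<sigma> = D c b u \<sigma>)) \<and>
           (\<forall>u \<tau>. smooth_section A E U \<tau> \<longrightarrow>
              D c b u (\<lambda>x. vadd E (\<sigma> x) (\<tau> x)) = vadd E (D c b u \<sigma>) (D c b u \<tau>)) \<and>
           (\<forall>u \<tau>. smooth_section A E U \<tau> \<and> (\<forall>x\<in>U. \<tau> x = \<sigma> x) \<longrightarrow> D c b u \<tau> = D c b u \<sigma>) \<and>
           (\<forall>u f. smooth_map A U f \<longrightarrow>
              D c b u (\<lambda>x. vscale E (f x) (\<sigma> x)) =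
                vadd E (vscale E (chart_deriv c f b u) (\<sigma> b)) (vscale E (f b) (D c b u \<sigma>)))))"

definition metric_compatible ::
  "('b::topological_space, 'n::finite) chart set \<Rightarrow> ('b, 'e, 'm::finite) vbundle \<Rightarrow> ('e \<Rightarrow> 'e \<Rightarrow> real) \<Rightarrow>
    ('b, 'n, 'e) connection \<Rightarrow> bool" where
  "metric_compatible A E G D \<longleftrightarrow>
     (\<forall>U \<sigma> \<tau>. open U \<and> smooth_section A E U \<sigma> \<and> smooth_section A E U \<tau> \<longrightarrow>
        (\<forall>c\<in>A. \<forall>b \<in> U \<inter> fst c. \<forall>u.
           chart_deriv c (\<lambda>x. G (\<sigma> x) (\<tau> x)) b u = G (D c b u \<sigma>) (\<tau> b) + G (\<sigma> b) (D c b u \<tau>)))"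

section \<open>Local orthonormal frames and the metric on the total space\<close>

definition orthonormal_coframe_on ::
  "('b, 'n::finite) chart set \<Rightarrow> ('b, 'n) metric \<Rightarrow> 'b set \<Rightarrow>
    ('n \<Rightarrow> ('b, 'n) chart \<Rightarrow> 'b \<Rightarrow> real^'n) \<Rightarrow> bool" where
  "orthonormal_coframe_on A g U \<beta> \<longleftrightarrow> (\<forall>i. one_form_on A U (\<beta> i)) \<and>
     (\<forall>c\<in>A. \<forall>b \<in> U \<inter> fst c. \<forall>i j.
        \<beta> i c b \<bullet> (matrix_inv (g c b) *v \<beta> j c b) = (if i = j then 1 else 0))"

definition orthonormal_frame_on ::
  "('b, 'n::finite) chart set \<Rightarrow> ('b, 'e, 'm::finite) vbundle \<Rightarrow> ('e \<Rightarrow> 'e \<Rightarrow> real) \<Rightarrow> 'b set \<Rightarrow>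
    ('m \<Rightarrow> 'b \<Rightarrow> 'e) \<Rightarrow> bool" where
  "orthonormal_frame_on A E G U \<sigma> \<longleftrightarrow> (\<forall>\<alpha>. smooth_section A E U (\<sigma> \<alpha>)) \<and>
     (\<forall>b\<in>U. \<forall>\<alpha> \<beta>. G (\<sigma> \<alpha> b) (\<sigma> \<beta> b) = (if \<alpha> = \<beta> then 1 else 0))"

text \<open>The coordinates \<open>x\<^sub>\<alpha>\<close> in \<open>e = x\<^sub>\<alpha> \<sigma>\<^sub>\<alpha>\<close> and the connection forms in
  \<open>\<nabla>\<sigma>\<^sub>\<beta> = \<omega>\<^sub>\<alpha>\<^sub>\<beta> \<sigma>\<^sub>\<alpha>\<close>, for an orthonormal frame.\<close>

definition fibre_coord ::
  "('b, 'e, 'm::finite) vbundle \<Rightarrow> ('e \<Rightarrow> 'e \<Rightarrow> real) \<Rightarrow> ('m \<Rightarrow> 'b \<Rightarrow> 'e) \<Rightarrow> 'm \<Rightarrow> 'e \<Rightarrow> real" where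
  "fibre_coord E G \<sigma> \<alpha> e = G e (\<sigma> \<alpha> (proj E e))"

definition connection_form ::
  "('e \<Rightarrow> 'e \<Rightarrow> real) \<Rightarrow> ('b, 'n, 'e) connection \<Rightarrow> ('m \<Rightarrow> 'b \<Rightarrow> 'e) \<Rightarrow> 'm \<Rightarrow> 'm \<Rightarrow>
    ('b, 'n) chart \<Rightarrow> 'b \<Rightarrow> real^'n \<Rightarrow> real" where
  "connection_form G D \<sigma> \<alpha> \<beta> c b u = G (D c b u (\<sigma> \<beta>)) (\<sigma> \<alpha> b)"

definition proj_deriv ::
  "('b, 'e, 'm::finite) vbundle \<Rightarrow> ('b, 'n::finite) chart \<Rightarrow> 'b set \<times> ('e \<Rightarrow> real^'m) \<Rightarrow> 'e \<Rightarrow> real^('n + 'm) \<Rightarrow> real^'n" where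
  "proj_deriv E c t = chart_deriv (bundle_chart E c t) (snd c \<circ> proj E)"

text \<open>\<open>\<zeta>\<^sub>\<alpha> = dx\<^sub>\<alpha> + x\<^sub>\<beta> \<omega>\<^sub>\<alpha>\<^sub>\<beta>\<close>, with \<open>\<omega>\<^sub>\<alpha>\<^sub>\<beta>\<close> pulled back from the base. A section \<open>x\<^sub>\<alpha> \<sigma>\<^sub>\<alpha>\<close> is
  parallel along a curve iff the \<open>\<zeta>\<^sub>\<alpha>\<close> vanish along it, so they annihilate the horizontal vectors.\<close>

definition vertical_form ::
  "('b, 'e, 'm::finite) vbundle \<Rightarrow> ('e \<Rightarrow> 'e \<Rightarrow> real) \<Rightarrow> ('b, 'n::finite, 'e) connection \<Rightarrow>
    ('m \<Rightarrow> 'b \<Rightarrow> 'e) \<Rightarrow> 'm \<Rightarrow> ('b, 'n) chart \<Rightarrow> 'b set \<times> ('e \<Rightarrow> real^'m) \<Rightarrow> 'e \<Rightarrow> real^('n + 'm) \<Rightarrow> real" where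
  "vertical_form E G D \<sigma> \<alpha> c t e w =
     chart_deriv (bundle_chart E c t) (fibre_coord E G \<sigma> \<alpha>) e w +
     (\<Sum>\<beta>\<in>UNIV. fibre_coord E G \<sigma> \<beta> e *
        connection_form G D \<sigma> \<alpha> \<beta> c (proj E e) (proj_deriv E c t e w))"

text \<open>\<open>g = h\<^sup>2 (\<Sum>\<^sub>i b\<^sub>i\<^sup>2) + k\<^sup>2 (\<Sum>\<^sub>\<alpha> \<zeta>\<^sub>\<alpha>\<^sup>2)\<close> for suitable orthonormal frames near every point of the base.
  The right-hand side does not depend on the choice of frames.\<close>

definition is_total_metric ::
  "('b::topological_space, 'n::finite) chart set \<Rightarrow> ('b, 'n) metric \<Rightarrow> ('b, 'e, 'm::finite) vbundle \<Rightarrow>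
    ('e \<Rightarrow> 'e \<Rightarrow> real) \<Rightarrow> ('b, 'n, 'e) connection \<Rightarrow> (real \<Rightarrow> real) \<Rightarrow> (real \<Rightarrow> real) \<Rightarrow>
    ('e, 'n + 'm) metric \<Rightarrow> bool" where
  "is_total_metric A gB E G D h k g \<longleftrightarrow>
     (\<forall>b0. \<exists>U \<beta> \<sigma>. open U \<and> b0 \<in> U \<and>
        orthonormal_coframe_on A gB U \<beta> \<and> orthonormal_frame_on A E G U \<sigma> \<and>
        (\<forall>c\<in>A. \<forall>t\<in>trivs E. \<forall>e \<in> proj E -` (U \<inter> fst c \<inter> fst t). \<forall>w w'.
           w \<bullet> (g (bundle_chart E c t) e *v w') =
             (h (fibre_radius G e))\<^sup>2 *
               (\<Sum>i\<in>UNIV. (\<beta> i c (proj E e) \<bullet> proj_deriv E c t e w) *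
                            (\<beta> i c (proj E e) \<bullet> proj_deriv E c t e w')) +
             (k (fibre_radius G e))\<^sup>2 *
               (\<Sum>\<alpha>\<in>UNIV. vertical_form E G D \<sigma> \<alpha> c t e w * vertical_form E G D \<sigma> \<alpha> c t e w')))"

end

theory Submission
  imports Defs
begin

text \<open>
  Let \<open>R\<close> be the Euler field, the radial vector field of the fibres, and let \<open>r\<close> be the fibre
  radius. Since \<open>R\<close> is vertical with \<open>\<zeta>\<^sub>\<alpha>(R) = x\<^sub>\<alpha>\<close>, the dual 1-form is
  \<open>g(R, \<cdot>) = k\<^sup>2 \<Sum>\<^sub>\<alpha> x\<^sub>\<alpha> \<zeta>\<^sub>\<alpha>\<close>. The connection forms are antisymmetric because the connection is
  compatible with the fibre metric, so they cancel in this sum, and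
  \<open>\<Sum>\<^sub>\<alpha> x\<^sub>\<alpha> \<zeta>\<^sub>\<alpha> = \<Sum>\<^sub>\<alpha> x\<^sub>\<alpha> dx\<^sub>\<alpha> = r dr\<close>. Hence \<open>g(R, \<cdot>) = \<phi>(r) dr\<close> with \<open>\<phi>(r) = k(r)\<^sup>2 r\<close>
  (\<open>\<rho>_gradient\<close>): up to a function of \<open>r\<close>, the gradient of \<open>r\<close> is the Euler field.

  Differentiating \<open>ds = \<tau>(r) g(R, \<cdot>)\<close> with \<open>\<tau> = s' / \<phi>\<close> covariantly gives
  \<open>Hess s (u, v) = \<tau>'(r) / \<phi>(r) g(R, u) g(R, v) + \<tau>(r) g(\<nabla>\<^sub>u R, v)\<close>. The trace of the second term is
  that of half the Lie derivative of \<open>g\<close> along \<open>R\<close>, so neither the Christoffel symbols nor the volume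
  density of \<open>g\<close> have to be computed (\<open>trace_hessian_radial\<close>).

  The flow of \<open>R\<close> is scaling in the fibres. It fixes the \<open>b\<^sub>i\<close> and multiplies \<open>r\<close> and, the connection
  being linear, the \<open>\<zeta>\<^sub>\<alpha>\<close> by \<open>l\<close>. Differentiating \<open>h(l r)\<^sup>2 \<Sum> b\<^sub>i\<^sup>2 + l\<^sup>2 k(l r)\<^sup>2 \<Sum> \<zeta>\<^sub>\<alpha>\<^sup>2\<close> at \<open>l = 1\<close> gives
  the Lie derivative \<open>2 h h' r \<Sum> b\<^sub>i\<^sup>2 + (2 k k' r + 2 k\<^sup>2) \<Sum> \<zeta>\<^sub>\<alpha>\<^sup>2\<close> (\<open>lie_derivative_euler_field\<close>). As
  \<open>\<Sum> b\<^sub>i\<^sup>2\<close> and \<open>\<Sum> \<zeta>\<^sub>\<alpha>\<^sup>2\<close> have traces \<open>n / h\<^sup>2\<close> and \<open>m / k\<^sup>2\<close> (\<open>trace_gm\<close>), and \<open>g(R, R) = k\<^sup>2 r\<^sup>2\<close>,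
  the Laplacian is \<open>r \<tau>' + \<tau> (n r h' / h + m (r k' / k + 1))\<close>. Inserting \<open>\<tau> = s' / (k\<^sup>2 r)\<close> gives the
  formula.
\<close>

section \<open>Smooth functions\<close>

lemma frechet_derivative_cong_open:
  assumes "open S" "x \<in> S" "\<And>y. y \<in> S \<Longrightarrow> f y = g y"
  shows "frechet_derivative f (at x) = frechet_derivative g (at x)"
proof -
  have "(f has_derivative D) (at x) \<longleftrightarrow> (g has_derivative D) (at x)" for D
    using assms by (metis (no_types, lifting) has_derivative_transform_within_open)
  then show ?thesis
    by (simp add: frechet_derivative_def)
qed

lemma differentiable_cong_open:
  assumes "open S" "x \<in> S" "\<And>y. y \<in> S \<Longrightarrow> f y = g y"
  shows "f differentiable (at x) \<longleftrightarrow> g differentiable (at x)"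
  using assms unfolding differentiable_def
  by (metis (no_types, lifting) has_derivative_transform_within_open)

lemma Ck_on_cong:
  assumes "open S" "\<And>x. x \<in> S \<Longrightarrow> f x = g x"
  shows "Ck_on k S f \<longleftrightarrow> Ck_on k S g"
  using assms(2)
proof (induction k arbitrary: f g)
  case 0
  then show ?case by (simp cong: continuous_on_cong)
next
  case (Suc k)
  have "Ck_on k S (\<lambda>x. frechet_derivative f (at x) v) \<longleftrightarrow> Ck_on k S (\<lambda>x. frechet_derivative g (at x) v)" for v
    by (rule Suc.IH) (metis Suc.prems assms(1) frechet_derivative_cong_open)
  then show ?case
    using Suc.prems differentiable_cong_open[OF assms(1), of _ f g] by auto
qed

text \<open>A bounded linear map commutes with every directional derivative. It is needed for the maps
  that evaluate a matrix at a fixed vector, which occur in the change of trivialisation.\<close>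

lemma Ck_on_bounded_linear:
  assumes "bounded_linear L" "open S" "Ck_on k S f"
  shows "Ck_on k S (\<lambda>x. L (f x))"
  using assms(3)
proof (induction k arbitrary: f)
  case 0
  then show ?case by (simp add: assms(1) linear_continuous_on_compose bounded_linear.continuous_on)
next
  case (Suc k)
  have D: "((\<lambda>x. L (f x)) has_derivative (\<lambda>v. L (frechet_derivative f (at x) v))) (at x)"
    if "x \<in> S" for x
    using Suc.prems that frechet_derivative_works by (auto intro!: bounded_linear.has_derivative[OF assms(1)])
  have "Ck_on k S (\<lambda>x. L (frechet_derivative f (at x) v))" for v
    using Suc by auto
  moreover have "frechet_derivative (\<lambda>x. L (f x)) (at x) v = L (frechet_derivative f (at x) v)"
    if "x \<in> S" for x v
    using frechet_derivative_at[OF D[OF that]] by metis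
  ultimately have "Ck_on k S (\<lambda>x. frechet_derivative (\<lambda>x. L (f x)) (at x) v)" for v
    using Ck_on_cong[OF assms(2), of "\<lambda>x. frechet_derivative (\<lambda>x. L (f x)) (at x) v"] by simp
  then show ?case
    using D by (auto simp: differentiable_def)
qed

lemma smooth_on_bounded_linear:
  assumes "bounded_linear L" "smooth_on S f"
  shows "smooth_on S (\<lambda>x. L (f x))"
proof -
  obtain T F where "open T" "S \<subseteq> T" "\<forall>x\<in>S. F x = f x" "\<forall>k. Ck_on k T F"
    using assms(2) unfolding smooth_on_def by blast
  then show ?thesis
    unfolding smooth_on_def
    by (intro exI[of _ T] exI[of _ "\<lambda>x. L (F x)"]) (auto intro: Ck_on_bounded_linear[OF assms(1)])
qed

lemma smooth_on_cong:
  assumes "smooth_on S f" "\<And>x. x \<in> S \<Longrightarrow> f x = g x"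
  shows "smooth_on S g"
  using assms unfolding smooth_on_def by (metis (no_types, lifting))

lemma smooth_on_subset:
  assumes "smooth_on S f" "S' \<subseteq> S"
  shows "smooth_on S' f"
  using assms unfolding smooth_on_def by (meson order_trans subsetD)

text \<open>The extension that witnesses smoothness agrees with \<open>f\<close> only on \<open>S\<close>, so its derivatives say
  something about \<open>f\<close> only at interior points of \<open>S\<close>.\<close>

lemma smooth_on_imp_differentiable:
  assumes "smooth_on S f" "open N" "N \<subseteq> S" "x \<in> N"
  shows "f differentiable (at x)"
proof -
  obtain T F where T: "open T" "S \<subseteq> T" "\<forall>x\<in>S. F x = f x" "\<forall>k. Ck_on k T F"
    using assms(1) unfolding smooth_on_def by blast
  have "F differentiable (at x)"
    using T(2) T(4)[rule_format, of "Suc 0"] assms(3,4) by auto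
  then show ?thesis
    using differentiable_cong_open[OF assms(2,4), of F f] T(3) assms(3) by auto
qed

lemma smooth_on_real_DERIV:
  fixes f :: "real \<Rightarrow> real"
  assumes "smooth_on S f" "open N" "N \<subseteq> S" "x \<in> N"
  shows "(f has_real_derivative deriv f x) (at x)"
  using smooth_on_imp_differentiable[OF assms]
  by (metis DERIV_deriv_iff_real_differentiable)

lemma smooth_on_real_DERIV2:
  fixes f :: "real \<Rightarrow> real"
  assumes "smooth_on S f" "open N" "N \<subseteq> S" "x \<in> N"
  shows "(deriv f has_real_derivative deriv (deriv f) x) (at x)"
proof -
  obtain T F where T: "open T" "S \<subseteq> T" "\<forall>x\<in>S. F x = f x" "\<forall>k. Ck_on k T F"
    using assms(1) unfolding smooth_on_def by blast
  have "(\<lambda>x. frechet_derivative F (at x) 1) differentiable (at x)"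
    using T(4)[rule_format, of "Suc (Suc 0)"] assms T(2) by auto
  moreover have "frechet_derivative F (at z) 1 = deriv f z" if "z \<in> N" for z
  proof -
    have "frechet_derivative F (at z) = frechet_derivative f (at z)"
      using frechet_derivative_cong_open[OF assms(2) that, of F f] T(3) assms(3) by auto
    moreover have "(f has_derivative (*) (deriv f z)) (at z)"
      using smooth_on_real_DERIV[OF assms(1-3) that] by (simp add: has_field_derivative_def)
    ultimately show ?thesis
      using frechet_derivative_at by (metis mult.right_neutral)
  qed
  ultimately have "deriv f differentiable (at x)"
    using differentiable_cong_open[OF assms(2,4), of "\<lambda>x. frechet_derivative F (at x) 1" "deriv f"] by auto
  then show ?thesis
    by (metis DERIV_deriv_iff_real_differentiable)
qed

section \<open>Traces with respect to a metric\<close>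

lemma matrix_inv_inverse:
  fixes M :: "real^'n^'n"
  assumes "invertible M"
  shows "M ** matrix_inv M = mat 1" "matrix_inv M ** M = mat 1"
  using assms unfolding invertible_def matrix_inv_def
  by (metis (mono_tags, lifting) someI_ex)+

lemma sym_matrix_inv:
  fixes M :: "real^'n^'n"
  assumes "invertible M" "transpose M = M"
  shows "matrix_inv M $ p $ q = matrix_inv M $ q $ p"
proof -
  have "M ** transpose (matrix_inv M) = mat 1"
    by (metis assms matrix_inv_inverse(2) matrix_transpose_mul transpose_mat)
  then have "transpose (matrix_inv M) = matrix_inv M"
    by (metis assms(1) matrix_inv_inverse(2) matrix_mul_assoc matrix_mul_lid matrix_mul_rid)
  then have "transpose (matrix_inv M) $ p $ q = matrix_inv M $ p $ q"
    by simp
  then show ?thesis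
    by (simp add: transpose_def)
qed

lemma pos_def_imp_invertible:
  fixes M :: "real^'n^'n"
  assumes "\<And>u. u \<noteq> 0 \<Longrightarrow> u \<bullet> (M *v u) > 0"
  shows "invertible M"
proof -
  have "\<forall>x. M *v x = 0 \<longrightarrow> x = 0"
    using assms by (metis inner_zero_right less_irrefl)
  then show ?thesis
    using invertible_left_inverse matrix_left_invertible_ker by blast
qed

lemma sym_matrix_inner:
  fixes M :: "real^'n^'n"
  assumes "transpose M = M"
  shows "u \<bullet> (M *v v) = v \<bullet> (M *v u)"
  by (metis assms dot_lmul_matrix inner_commute transpose_matrix_vector)

text \<open>If the linear forms \<open>\<theta>\<^sub>l\<close> diagonalise a metric with weights \<open>a\<^sub>l\<close>, they are a basis that is
  orthogonal for the inverse metric, with squared lengths \<open>1 / a\<^sub>l\<close>. In matrices: \<open>M = J\<^sup>T a J\<close>, where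
  the rows of \<open>J\<close> are the \<open>\<theta>\<^sub>l\<close>, so \<open>J M\<^sup>-\<^sup>1\<close> is a right inverse of \<open>J\<^sup>T a\<close>, hence also a
  left inverse, and the claim is a diagonal entry of \<open>J M\<^sup>-\<^sup>1 J\<^sup>T a = 1\<close>. That the
  \<open>\<theta>\<^sub>l\<close> are independent and the \<open>a\<^sub>l\<close> nonzero follows from the invertibility of \<open>M\<close>.\<close>

lemma trace_diagonalised:
  fixes M :: "real^'n^'n" and \<theta> :: "'n \<Rightarrow> real^'n \<Rightarrow> real"
  assumes inv: "invertible M" and lin: "\<And>l. linear (\<theta> l)"
    and diag: "\<And>u v. u \<bullet> (M *v v) = (\<Sum>l\<in>UNIV. a l * \<theta> l u * \<theta> l v)"
  shows "(\<Sum>p\<in>UNIV. \<Sum>q\<in>UNIV. matrix_inv M $ p $ q * (\<theta> l (axis p 1) * \<theta> l (axis q 1))) = 1 / a l"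
proof -
  define J :: "real^'n^'n" where "J = (\<chi> l p. \<theta> l (axis p 1))"
  define K :: "real^'n^'n" where "K = (\<chi> p l. \<theta> l (axis p 1) * a l)"
  have M: "M = K ** J"
  proof -
    have "M $ p $ q = (\<Sum>l\<in>UNIV. a l * \<theta> l (axis p 1) * \<theta> l (axis q 1))" for p q
      using diag[of "axis p 1" "axis q 1"]
      by (simp add: matrix_vector_mult_basis column_def inner_axis inner_commute[of "axis p 1"])
    then show ?thesis
      by (simp add: vec_eq_iff matrix_matrix_mult_def J_def K_def mult_ac)
  qed
  have "K ** (J ** matrix_inv M) = mat 1"
    using matrix_inv_inverse(1)[OF inv] M by (simp add: matrix_mul_assoc)
  then have "(J ** matrix_inv M) ** K = mat 1"
    by (simp add: matrix_left_right_inverse)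
  then have "((J ** matrix_inv M) ** K) $ l $ l = 1"
    by (simp add: mat_def)
  then have "(\<Sum>q\<in>UNIV. (\<Sum>p\<in>UNIV. \<theta> l (axis p 1) * matrix_inv M $ p $ q) * (\<theta> l (axis q 1) * a l)) = 1"
    by (simp add: matrix_matrix_mult_def J_def K_def)
  then have "(\<Sum>p\<in>UNIV. \<Sum>q\<in>UNIV. matrix_inv M $ p $ q * (\<theta> l (axis p 1) * \<theta> l (axis q 1))) * a l = 1"
    by (subst sum.swap) (simp add: sum_distrib_left sum_distrib_right mult_ac)
  then show ?thesis
    by (cases "a l = 0") (auto simp: nonzero_eq_divide_eq)
qed

text \<open>The 1-form dual to a vector has the same length as the vector.\<close>

lemma trace_flat_square:
  fixes M :: "real^'n^'n"
  assumes "invertible M" "transpose M = M"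
  shows "(\<Sum>p\<in>UNIV. \<Sum>q\<in>UNIV. matrix_inv M $ p $ q * ((x \<bullet> (M *v axis p 1)) * (x \<bullet> (M *v axis q 1))))
    = x \<bullet> (M *v x)"
proof -
  have c: "x \<bullet> (M *v axis p 1) = (M *v x) $ p" for p
    by (subst sym_matrix_inner[OF assms(2)]) (simp add: inner_axis')
  have "x \<bullet> (M *v x) = (M *v x) \<bullet> (matrix_inv M *v (M *v x))"
    by (simp add: matrix_vector_mul_assoc matrix_inv_inverse[OF assms(1)] inner_commute)
  also have "\<dots> = (\<Sum>p\<in>UNIV. \<Sum>q\<in>UNIV. matrix_inv M $ p $ q * ((M *v x) $ p * (M *v x) $ q))"
    unfolding inner_vec_def
    by (subst (2) matrix_vector_mult_def) (simp add: sum_distrib_left mult_ac)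
  finally show ?thesis
    by (simp add: c)
qed

section \<open>The Hessian of a function of the radius\<close>

lemma bounded_linear_matrix_vector_mult: "bounded_linear (\<lambda>X :: real^'n^'m. X *v v)"
  by (auto intro!: linear_conv_bounded_linear[THEN iffD1] linearI
      simp: matrix_vector_mult_add_rdistrib scaleR_matrix_vector_assoc[symmetric])

text \<open>The coordinate computation behind the theorem. \<open>P\<close> is a vector field with linear
  coefficients, and the hypothesis on \<open>\<rho>\<close> says that \<open>g(P, \<cdot>) = \<phi>(\<rho>) d\<rho>\<close>. With \<open>\<tau> = s' / \<phi>\<close> this
  gives \<open>d(s \<circ> \<rho>) = \<tau>(\<rho>) g(P, \<cdot>)\<close>, hence
  \<open>Hess (s \<circ> \<rho>) (u, v) = \<tau>'(\<rho>) / \<phi>(\<rho>) g(P, u) g(P, v) + \<tau>(\<rho>) g(\<nabla>\<^sub>u P, v)\<close>.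
  A trace sees only the symmetric part of the last term, which for a torsion-free metric
  connection is half the Lie derivative of \<open>g\<close> along \<open>P\<close>: that is the bracket in the last sum. So
  the Christoffel symbols drop out of the trace.\<close>

lemma trace_hessian_radial:
  fixes M :: "real^'N \<Rightarrow> real^'N^'N" and P :: "real^'N \<Rightarrow> real^'N"
    and \<rho> :: "real^'N \<Rightarrow> real" and s s1 \<phi> :: "real \<Rightarrow> real"
    and \<Gamma> :: "real^'N \<Rightarrow> real^'N \<Rightarrow> real^'N"
  assumes W: "open W" "y \<in> W"
    and M: "M differentiable (at y)" "transpose (M y) = M y" "invertible (M y)"
    and P: "bounded_linear P"
    and \<rho>: "\<And>z. z \<in> W \<Longrightarrow> (\<rho> has_derivative (\<lambda>w. (P z \<bullet> (M z *v w)) / \<phi> (\<rho> z))) (at z)"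
    and s: "\<And>z. z \<in> W \<Longrightarrow> (s has_real_derivative s1 (\<rho> z)) (at (\<rho> z))"
    and s1: "(s1 has_real_derivative s2) (at (\<rho> y))"
    and \<phi>: "(\<phi> has_real_derivative \<phi>1) (at (\<rho> y))" "\<phi> (\<rho> y) \<noteq> 0"
    and torsion_free: "\<And>u v. \<Gamma> u v = \<Gamma> v u"
    and compatible: "\<And>u v w. frechet_derivative (\<lambda>z. v \<bullet> (M z *v w)) (at y) u =
          \<Gamma> u v \<bullet> (M y *v w) + v \<bullet> (M y *v \<Gamma> u w)"
  shows "(\<Sum>p\<in>UNIV. \<Sum>q\<in>UNIV. matrix_inv (M y) $ p $ q *
      (frechet_derivative (\<lambda>z. frechet_derivative (\<lambda>x. s (\<rho> x)) (at z) (axis q 1)) (at y) (axis p 1)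
       - frechet_derivative (\<lambda>x. s (\<rho> x)) (at y) (\<Gamma> (axis p 1) (axis q 1)))) =
    (s2 - s1 (\<rho> y) * \<phi>1 / \<phi> (\<rho> y)) * (P y \<bullet> (M y *v P y)) / (\<phi> (\<rho> y))\<^sup>2
    + s1 (\<rho> y) / \<phi> (\<rho> y) / 2 * (\<Sum>p\<in>UNIV. \<Sum>q\<in>UNIV. matrix_inv (M y) $ p $ q *
        (frechet_derivative (\<lambda>z. axis p 1 \<bullet> (M z *v axis q 1)) (at y) (P y)
         + P (axis p 1) \<bullet> (M y *v axis q 1) + axis p 1 \<bullet> (M y *v P (axis q 1))))"
proof -
  define \<tau> where "\<tau> x = s1 x / \<phi> x" for x
  define \<tau>1 where "\<tau>1 = s2 / \<phi> (\<rho> y) - s1 (\<rho> y) * \<phi>1 / (\<phi> (\<rho> y))\<^sup>2"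
  let ?m = "\<lambda>p q. matrix_inv (M y) $ p $ q"
  let ?e = "\<lambda>p. axis p (1::real)"
  have \<tau>: "(\<tau> has_real_derivative \<tau>1) (at (\<rho> y))"
    unfolding \<tau>_def[abs_def] \<tau>1_def
    by (rule derivative_eq_intros s1 \<phi> refl)+ (use \<phi>(2) in \<open>simp add: field_simps power2_eq_square\<close>)
  have df: "frechet_derivative (\<lambda>x. s (\<rho> x)) (at z) v = \<tau> (\<rho> z) * (P z \<bullet> (M z *v v))" if "z \<in> W" for z v
  proof -
    have "((\<lambda>x. s (\<rho> x)) has_derivative (\<lambda>w. s1 (\<rho> z) * ((P z \<bullet> (M z *v w)) / \<phi> (\<rho> z)))) (at z)"
      using has_derivative_compose[OF \<rho>[OF that] s[OF that, unfolded has_field_derivative_def]] .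
    from frechet_derivative_at[OF this] show ?thesis
      unfolding \<tau>_def by (metis times_divide_eq_left times_divide_eq_right)
  qed
  obtain M' where M': "(M has_derivative M') (at y)"
    using M(1) by (auto simp: differentiable_def)
  have P': "(P has_derivative P) (at y)"
    using P by (rule bounded_linear_imp_has_derivative)
  have Mv: "((\<lambda>z. M z *v w) has_derivative (\<lambda>u. M' u *v w)) (at y)" for w
    by (rule bounded_linear.has_derivative[OF bounded_linear_matrix_vector_mult M'])
  have M'': "v \<bullet> (M' u *v w) = \<Gamma> u v \<bullet> (M y *v w) + v \<bullet> (M y *v \<Gamma> u w)" for u v w
    using compatible[of v w u] frechet_derivative_at[OF has_derivative_inner_right[OF Mv[of w]], of v]
    by metis
  have Q: "((\<lambda>z. \<tau> (\<rho> z) * (P z \<bullet> (M z *v v))) has_derivative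
      (\<lambda>u. \<tau> (\<rho> y) * (P y \<bullet> (M' u *v v) + P u \<bullet> (M y *v v))
          + \<tau>1 * ((P y \<bullet> (M y *v u)) / \<phi> (\<rho> y)) * (P y \<bullet> (M y *v v)))) (at y)" for v
  proof (rule has_derivative_mult)
    show "((\<lambda>z. \<tau> (\<rho> z)) has_derivative (\<lambda>u. \<tau>1 * ((P y \<bullet> (M y *v u)) / \<phi> (\<rho> y)))) (at y)"
      using has_derivative_compose[OF \<rho>[OF W(2)] \<tau>[unfolded has_field_derivative_def]] .
    show "((\<lambda>z. P z \<bullet> (M z *v v)) has_derivative (\<lambda>u. P y \<bullet> (M' u *v v) + P u \<bullet> (M y *v v))) (at y)"
      by (rule has_derivative_inner[OF P' Mv])
  qed
  define H where "H u v = frechet_derivative (\<lambda>z. frechet_derivative (\<lambda>x. s (\<rho> x)) (at z) v) (at y) u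
       - frechet_derivative (\<lambda>x. s (\<rho> x)) (at y) (\<Gamma> u v)" for u v
  \<comment> \<open>\<open>B u v\<close> is \<open>g(\<nabla>\<^sub>u P, v)\<close>, because \<open>P\<close> is its own derivative.\<close>
  define B where "B u v = \<Gamma> u (P y) \<bullet> (M y *v v) + P u \<bullet> (M y *v v)" for u v
  have H: "H u v = \<tau>1 / \<phi> (\<rho> y) * ((P y \<bullet> (M y *v u)) * (P y \<bullet> (M y *v v))) + \<tau> (\<rho> y) * B u v" for u v
  proof -
    have "frechet_derivative (\<lambda>z. frechet_derivative (\<lambda>x. s (\<rho> x)) (at z) v) (at y)
        = frechet_derivative (\<lambda>z. \<tau> (\<rho> z) * (P z \<bullet> (M z *v v))) (at y)"
      by (rule frechet_derivative_cong_open[OF W]) (rule df)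
    then show ?thesis
      unfolding H_def frechet_derivative_at[OF Q, symmetric] df[OF W(2)] M'' B_def
      by (simp add: algebra_simps)
  qed
  have BB: "B u v + B v u = frechet_derivative (\<lambda>z. u \<bullet> (M z *v v)) (at y) (P y)
         + P u \<bullet> (M y *v v) + u \<bullet> (M y *v P v)" for u v
    unfolding B_def compatible
    using sym_matrix_inner[OF M(2)] torsion_free[of "P y"] by (simp add: algebra_simps)
  have "(\<Sum>p\<in>UNIV. \<Sum>q\<in>UNIV. ?m p q * B (?e p) (?e q)) = (\<Sum>p\<in>UNIV. \<Sum>q\<in>UNIV. ?m p q * B (?e q) (?e p))"
    by (subst sum.swap) (simp add: sym_matrix_inv[OF M(3,2)])
  then have "2 * (\<Sum>p\<in>UNIV. \<Sum>q\<in>UNIV. ?m p q * B (?e p) (?e q))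
      = (\<Sum>p\<in>UNIV. \<Sum>q\<in>UNIV. ?m p q * (B (?e p) (?e q) + B (?e q) (?e p)))"
    by (simp add: distrib_left sum.distrib)
  moreover have "(\<Sum>p\<in>UNIV. \<Sum>q\<in>UNIV. ?m p q * H (?e p) (?e q)) =
      \<tau>1 / \<phi> (\<rho> y) * (P y \<bullet> (M y *v P y)) + \<tau> (\<rho> y) * (\<Sum>p\<in>UNIV. \<Sum>q\<in>UNIV. ?m p q * B (?e p) (?e q))"
    unfolding trace_flat_square[OF M(3,2), symmetric]
    by (simp add: H sum_distrib_left sum.distrib algebra_simps)
  ultimately have "(\<Sum>p\<in>UNIV. \<Sum>q\<in>UNIV. ?m p q * H (?e p) (?e q)) =
      \<tau>1 / \<phi> (\<rho> y) * (P y \<bullet> (M y *v P y))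
      + \<tau> (\<rho> y) / 2 * (\<Sum>p\<in>UNIV. \<Sum>q\<in>UNIV. ?m p q * (B (?e p) (?e q) + B (?e q) (?e p)))"
    by simp
  moreover have "\<tau>1 / \<phi> (\<rho> y) = (s2 - s1 (\<rho> y) * \<phi>1 / \<phi> (\<rho> y)) / (\<phi> (\<rho> y))\<^sup>2"
    using \<phi>(2) by (simp add: \<tau>1_def field_simps power2_eq_square)
  ultimately show ?thesis
    unfolding H_def BB \<tau>_def by simp
qed

section \<open>Coordinates on the total space\<close>

definition base_part :: "real^('n::finite + 'm::finite) \<Rightarrow> real^'n" where
  "base_part y = (\<chi> i. y $ Inl i)"

definition fibre_part :: "real^('n::finite + 'm::finite) \<Rightarrow> real^'m" where
  "fibre_part y = (\<chi> \<alpha>. y $ Inr \<alpha>)"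

definition euler_field :: "real^('n::finite + 'm::finite) \<Rightarrow> real^('n + 'm)" where
  "euler_field y = (\<chi> p. case p of Inl i \<Rightarrow> 0 | Inr \<alpha> \<Rightarrow> y $ Inr \<alpha>)"

text \<open>Multiplication by \<open>l\<close> in the fibres. The form chosen here exhibits the Euler field as the
  derivative in \<open>l\<close>.\<close>

definition fibre_scale :: "real \<Rightarrow> real^('n::finite + 'm::finite) \<Rightarrow> real^('n + 'm)" where
  "fibre_scale l y = y + (l - 1) *\<^sub>R euler_field y"

lemma parts_eqI:
  assumes "base_part y = base_part z" "fibre_part y = fibre_part z"
  shows "y = z"
proof -
  have "y $ p = z $ p" for p
    using assms by (cases p) (auto simp: base_part_def fibre_part_def vec_eq_iff)
  then show ?thesis
    by (simp add: vec_eq_iff)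
qed

lemma bounded_linear_base_part: "bounded_linear base_part"
  by (auto simp: base_part_def vec_eq_iff intro!: linear_conv_bounded_linear[THEN iffD1] linearI)

lemma bounded_linear_fibre_part: "bounded_linear fibre_part"
  by (auto simp: fibre_part_def vec_eq_iff intro!: linear_conv_bounded_linear[THEN iffD1] linearI)

lemma bounded_linear_euler_field: "bounded_linear euler_field"
  by (auto simp: euler_field_def vec_eq_iff split: sum.split
      intro!: linear_conv_bounded_linear[THEN iffD1] linearI)

lemma parts_euler_field [simp]:
  "base_part (euler_field y) = 0" "fibre_part (euler_field y) = fibre_part y"
  by (simp_all add: base_part_def fibre_part_def euler_field_def vec_eq_iff)

lemma parts_fibre_scale [simp]:
  "base_part (fibre_scale l y) = base_part y" "fibre_part (fibre_scale l y) = l *\<^sub>R fibre_part y"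
  by (simp_all add: base_part_def fibre_part_def fibre_scale_def euler_field_def vec_eq_iff algebra_simps)

text \<open>As many orthonormal vectors as the dimension form a basis: the matrix of the
  \<open>\<sigma>\<^sub>\<alpha>\<close> has the matrix of the functionals \<open>Q (\<cdot>, \<sigma>\<^sub>\<alpha>)\<close> as a left, hence
  two-sided, inverse.\<close>

lemma orthonormal_expansion:
  fixes Q :: "real^'m \<Rightarrow> real^'m \<Rightarrow> real" and \<sigma> :: "'m \<Rightarrow> real^'m"
  assumes Q: "bilinear Q" and orth: "\<And>\<alpha> \<beta>. Q (\<sigma> \<alpha>) (\<sigma> \<beta>) = (if \<alpha> = \<beta> then 1 else 0)"
  shows "Q v v = (\<Sum>\<alpha>\<in>UNIV. (Q v (\<sigma> \<alpha>))\<^sup>2)"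
proof -
  define S :: "real^'m^'m" where "S = (\<chi> i \<alpha>. \<sigma> \<alpha> $ i)"
  define L :: "real^'m^'m" where "L = (\<chi> \<alpha> i. Q (axis i 1) (\<sigma> \<alpha>))"
  have lin: "linear (\<lambda>v. Q v w)" "linear (Q w)" for w
    using Q by (auto simp: bilinear_def)
  have L: "(L *v w) $ \<alpha> = Q w (\<sigma> \<alpha>)" for w \<alpha>
  proof -
    have "Q w (\<sigma> \<alpha>) = Q (\<Sum>i\<in>UNIV. w $ i *\<^sub>R axis i 1) (\<sigma> \<alpha>)"
      using basis_expansion[of w] by (simp add: scalar_mult_eq_scaleR)
    also have "\<dots> = (\<Sum>i\<in>UNIV. w $ i * Q (axis i 1) (\<sigma> \<alpha>))"
      by (simp add: linear_sum[OF lin(1)] linear_cmul[OF lin(1)])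
    finally show ?thesis
      by (simp add: L_def matrix_vector_mult_def mult.commute)
  qed
  have S: "S *v x = (\<Sum>\<alpha>\<in>UNIV. x $ \<alpha> *\<^sub>R \<sigma> \<alpha>)" for x
    by (simp add: S_def matrix_vector_mult_def vec_eq_iff mult.commute)
  have "L ** S = mat 1"
  proof -
    have "(L ** S) $ \<alpha> $ \<beta> = (L *v \<sigma> \<beta>) $ \<alpha>" for \<alpha> \<beta>
      by (simp add: matrix_matrix_mult_def matrix_vector_mult_def S_def)
    then show ?thesis
      by (auto simp: vec_eq_iff mat_def L orth)
  qed
  then have "S *v (L *v v) = v"
    by (metis matrix_left_right_inverse matrix_vector_mul_assoc matrix_vector_mul_lid)
  then have "Q v v = Q v (\<Sum>\<alpha>\<in>UNIV. Q v (\<sigma> \<alpha>) *\<^sub>R \<sigma> \<alpha>)"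
    by (simp add: S L)
  then show ?thesis
    by (simp add: linear_sum[OF lin(2)] linear_cmul[OF lin(2)] power2_eq_square)
qed

lemma is_chartD:
  assumes "is_chart c"
  shows "b \<in> fst c \<Longrightarrow> chart_inv c (snd c b) = b"
    and "z \<in> snd c ` fst c \<Longrightarrow> snd c (chart_inv c z) = z"
    and "open V \<Longrightarrow> V \<subseteq> fst c \<Longrightarrow> open (snd c ` V)"
proof -
  have hom: "homeomorphism (fst c) (snd c ` fst c) (snd c) (chart_inv c)"
    and op: "open (snd c ` fst c)"
    using assms by (auto simp: is_chart_def)
  show inv: "b \<in> fst c \<Longrightarrow> chart_inv c (snd c b) = b" for b
    using homeomorphism_apply1[OF hom] .
  then show "z \<in> snd c ` fst c \<Longrightarrow> snd c (chart_inv c z) = z"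
    by auto
  show "open V \<Longrightarrow> V \<subseteq> fst c \<Longrightarrow> open (snd c ` V)"
    using homeomorphism_imp_open_map[OF hom, of V] op
    by (metis inf.absorb_iff2 open_openin openin_open openin_open_trans)
qed

lemma smooth_section_subset:
  assumes "smooth_section A E U \<sigma>" "U' \<subseteq> U"
  shows "smooth_section A E U' \<sigma>"
proof -
  have "smooth_map A (U' \<inter> fst t) (snd t \<circ> \<sigma>)" if "t \<in> trivs E" for t
    using assms that unfolding smooth_section_def smooth_map_def
    by (meson Int_mono image_mono order_refl smooth_on_subset)
  then show ?thesis
    using assms by (auto simp: smooth_section_def)
qed

text \<open>A product chart of the total space given by \<open>c\<close> and \<open>t\<close>, together with an orthonormal frame
  \<open>\<sigma>\<close> of the bundle over \<open>U\<close>. All functions and forms are written below as functions of the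
  coordinates \<open>y\<close> in this chart.\<close>

locale framed_bundle =
  fixes A :: "('b::topological_space, 'n::finite) chart set"
    and E :: "('b, 'e::topological_space, 'm::finite) vbundle"
    and G :: "'e \<Rightarrow> 'e \<Rightarrow> real"
    and D :: "('b, 'n, 'e) connection"
    and c :: "('b, 'n) chart"
    and t :: "'b set \<times> ('e \<Rightarrow> real^'m)"
    and U :: "'b set"
    and \<sigma> :: "'m \<Rightarrow> 'b \<Rightarrow> 'e"
  assumes atlas: "smooth_atlas A" and vbundle: "vector_bundle A E"
    and fmetric: "fibre_metric A E G" and connection: "bundle_connection A E D"
    and compatible: "metric_compatible A E G D"
    and c: "c \<in> A" and t: "t \<in> trivs E" and open_U: "open U"
    and frame: "orthonormal_frame_on A E G U \<sigma>"
begin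

abbreviation C where "C \<equiv> bundle_chart E c t"

abbreviation V where "V \<equiv> U \<inter> fst c \<inter> fst t"

text \<open>The coordinates of the part of the chart that lies over the domain of the frame. It
  contains whole fibres and is therefore stable under scaling.\<close>

definition dom :: "(real^('n + 'm)) set" where
  "dom = {y. base_part y \<in> snd c ` V}"

lemma chart: "is_chart c"
  using atlas c by (auto simp: smooth_atlas_def)

lemmas triv_structure = vbundle[unfolded vector_bundle_def, THEN conjunct2, THEN conjunct2,
  THEN conjunct2, THEN conjunct2, THEN conjunct1, THEN bspec, OF t]

lemma triv: "open (fst t)"
  "proj E a \<in> fst t \<Longrightarrow> proj E a = proj E a' \<Longrightarrow> snd t (vadd E a a') = snd t a + snd t a'"
  "proj E a \<in> fst t \<Longrightarrow> snd t (vscale E l a) = l *\<^sub>R snd t a"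
proof -
  show "open (fst t)"
    using triv_structure by (rule conjunct1)
  show "snd t (vadd E a a') = snd t a + snd t a'" if "proj E a \<in> fst t" "proj E a = proj E a'"
    using triv_structure[THEN conjunct2, THEN conjunct2, THEN conjunct1, THEN bspec[of _ _ a]] that by simp
  show "snd t (vscale E l a) = l *\<^sub>R snd t a" if "proj E a \<in> fst t"
    using triv_structure[THEN conjunct2, THEN conjunct2, THEN conjunct2, THEN bspec[of _ _ a]] that by simp
qed

lemma proj_ops: "proj E a = proj E a' \<Longrightarrow> proj E (vadd E a a') = proj E a"
  "proj E (vscale E l a) = proj E a"
  using vbundle[unfolded vector_bundle_def, THEN conjunct2, THEN conjunct1]
    vbundle[unfolded vector_bundle_def, THEN conjunct2, THEN conjunct2, THEN conjunct1] by simp_all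

lemma open_V: "open V" "open (snd c ` V)"
proof -
  have "open (fst c)"
    using chart by (auto simp: is_chart_def)
  then show "open V"
    using open_U triv(1) by auto
  then show "open (snd c ` V)"
    by (intro is_chartD(3)[OF chart]) auto
qed

lemma open_dom: "open dom"
proof -
  have "open (base_part -` (snd c ` V))"
    by (rule open_vimage[OF open_V(2)]) (rule linear_continuous_on[OF bounded_linear_base_part])
  then show ?thesis
    by (simp add: dom_def vimage_def)
qed

lemma fibre_point_ex: "b \<in> fst t \<Longrightarrow> \<exists>a. proj E a = b \<and> snd t a = v"
  and fibre_point_unique: "proj E a \<in> fst t \<Longrightarrow> proj E a = proj E a' \<Longrightarrow> snd t a = snd t a' \<Longrightarrow> a = a'"
proof -
  obtain \<Psi> where hom: "homeomorphism (proj E -` fst t) (fst t \<times> UNIV) (\<lambda>e. (proj E e, snd t e)) \<Psi>"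
    using triv_structure by blast
  show "\<exists>a. proj E a = b \<and> snd t a = v" if "b \<in> fst t"
    using homeomorphism_apply2[OF hom, of "(b, v)"] that by auto
  show "a = a'" if "proj E a \<in> fst t" "proj E a = proj E a'" "snd t a = snd t a'"
    using homeomorphism_apply1[OF hom, of a] homeomorphism_apply1[OF hom, of a'] that by auto
qed

text \<open>The inverse of the trivialisation.\<close>

definition fibre_point :: "'b \<Rightarrow> real^'m \<Rightarrow> 'e" where
  "fibre_point b v = (SOME a. proj E a = b \<and> snd t a = v)"

lemma fibre_point: "b \<in> fst t \<Longrightarrow> proj E (fibre_point b v) = b" "b \<in> fst t \<Longrightarrow> snd t (fibre_point b v) = v"
  using someI_ex[OF fibre_point_ex] unfolding fibre_point_def by auto

lemma fibre_point_eqI: "proj E a = b \<Longrightarrow> snd t a = v \<Longrightarrow> b \<in> fst t \<Longrightarrow> fibre_point b v = a"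
  using fibre_point fibre_point_unique by metis

lemma snd_C: "base_part (snd C a) = snd c (proj E a)" "fibre_part (snd C a) = snd t a"
  by (simp_all add: bundle_chart_def base_part_def fibre_part_def vec_eq_iff)

lemma inj_C: "inj_on (snd C) (fst C)"
proof (rule inj_onI)
  fix a a' assume a: "a \<in> fst C" "a' \<in> fst C" and eq: "snd C a = snd C a'"
  have "snd c (proj E a) = snd c (proj E a')" "snd t a = snd t a'"
    using snd_C[of a] snd_C[of a'] eq by auto
  moreover have "proj E a \<in> fst c \<inter> fst t" "proj E a' \<in> fst c \<inter> fst t"
    using a by (auto simp: bundle_chart_def)
  ultimately show "a = a'"
    using is_chartD(1)[OF chart] fibre_point_unique by (metis IntD1 IntD2)
qed

lemma C_inv_left: "a \<in> fst C \<Longrightarrow> chart_inv C (snd C a) = a"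
  by (simp add: chart_inv_def inv_into_f_f[OF inj_C])

lemma C_inv:
  assumes "y \<in> dom"
  shows "chart_inv c (base_part y) \<in> V"
    and "chart_inv C y = fibre_point (chart_inv c (base_part y)) (fibre_part y)"
    and "snd C (chart_inv C y) = y"
    and "chart_inv C y \<in> fst C"
    and "proj E (chart_inv C y) = chart_inv c (base_part y)"
    and "snd t (chart_inv C y) = fibre_part y"
proof -
  let ?b = "chart_inv c (base_part y)"
  let ?a = "fibre_point ?b (fibre_part y)"
  show b: "?b \<in> V"
    using assms is_chartD(1)[OF chart] by (auto simp: dom_def)
  have sb: "snd c ?b = base_part y"
    using assms is_chartD(2)[OF chart] by (auto simp: dom_def)
  have y: "snd C ?a = y"
    using snd_C fibre_point b sb by (intro parts_eqI) auto
  have a: "?a \<in> fst C"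
    using fibre_point b by (auto simp: bundle_chart_def)
  show eq: "chart_inv C y = ?a"
    using C_inv_left[OF a] y by simp
  show "snd C (chart_inv C y) = y" "chart_inv C y \<in> fst C"
    using y a eq by auto
  show "proj E (chart_inv C y) = ?b" "snd t (chart_inv C y) = fibre_part y"
    using eq fibre_point b by auto
qed

lemma snd_C_in_dom: "a \<in> fst C \<Longrightarrow> proj E a \<in> U \<Longrightarrow> snd C a \<in> dom"
  unfolding dom_def mem_Collect_eq snd_C by (auto simp: bundle_chart_def)

lemma fibre_scale_in_dom: "y \<in> dom \<Longrightarrow> fibre_scale l y \<in> dom"
  by (simp add: dom_def)

subsection \<open>The fibre metric\<close>

lemma G_sym: "proj E a = proj E a' \<Longrightarrow> G a a' = G a' a"
  and G_vadd: "proj E a = proj E a'' \<Longrightarrow> proj E a' = proj E a'' \<Longrightarrow> G (vadd E a a') a'' = G a a'' + G a' a''"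
  and G_vscale: "proj E a = proj E a' \<Longrightarrow> G (vscale E l a) a' = l * G a a'"
proof -
  note G = fmetric[unfolded fibre_metric_def]
  show "proj E a = proj E a' \<Longrightarrow> G a a' = G a' a"
    using G[THEN conjunct1] by simp
  show "proj E a = proj E a'' \<Longrightarrow> proj E a' = proj E a'' \<Longrightarrow> G (vadd E a a') a'' = G a a'' + G a' a''"
    using G[THEN conjunct2, THEN conjunct1] by simp
  show "proj E a = proj E a' \<Longrightarrow> G (vscale E l a) a' = l * G a a'"
    using G[THEN conjunct2, THEN conjunct2, THEN conjunct1] by simp
qed

text \<open>The vector operations of the fibre become those of \<open>real^'m\<close> in the trivialisation.\<close>

lemma linear_G_fibre_point:
  assumes "b \<in> fst t" "proj E a = b"
  shows "linear (\<lambda>v. G (fibre_point b v) a)"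
proof (rule linearI)
  fix v w
  have "fibre_point b (v + w) = vadd E (fibre_point b v) (fibre_point b w)"
    using assms by (intro fibre_point_eqI) (auto simp: proj_ops fibre_point triv)
  then show "G (fibre_point b (v + w)) a = G (fibre_point b v) a + G (fibre_point b w) a"
    using assms by (simp add: G_vadd fibre_point)
next
  fix l v
  have "fibre_point b (l *\<^sub>R v) = vscale E l (fibre_point b v)"
    using assms by (intro fibre_point_eqI) (auto simp: proj_ops fibre_point triv)
  then show "G (fibre_point b (l *\<^sub>R v)) a = l *\<^sub>R G (fibre_point b v) a"
    using assms by (simp add: G_vscale fibre_point)
qed

lemma proj_frame: "b \<in> U \<Longrightarrow> proj E (\<sigma> \<alpha> b) = b"
  and smooth_frame: "smooth_section A E U (\<sigma> \<alpha>)"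
  and G_frame: "b \<in> U \<Longrightarrow> G (\<sigma> \<alpha> b) (\<sigma> \<beta> b) = (if \<alpha> = \<beta> then 1 else 0)"
  using frame unfolding orthonormal_frame_on_def smooth_section_def by blast+

lemma G_frame_expansion:
  assumes "b \<in> U \<inter> fst t" "proj E a = b"
  shows "G a a = (\<Sum>\<alpha>\<in>UNIV. (fibre_coord E G \<sigma> \<alpha> a)\<^sup>2)"
proof -
  have b: "b \<in> fst t" "b \<in> U"
    using assms by auto
  define Q where "Q v w = G (fibre_point b v) (fibre_point b w)" for v w
  have sym: "Q v w = Q w v" for v w
    unfolding Q_def using b by (intro G_sym) (simp add: fibre_point)
  have lin: "linear (\<lambda>v. Q v w)" for w
    unfolding Q_def using b by (intro linear_G_fibre_point) (auto simp: fibre_point)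
  then have "linear (\<lambda>w. Q v w)" for v
    by (subst sym)
  with lin have bil: "bilinear Q"
    by (simp add: bilinear_def)
  have fpa: "fibre_point b (snd t a) = a"
    using assms b by (intro fibre_point_eqI) auto
  have fps: "fibre_point b (snd t (\<sigma> \<alpha> b)) = \<sigma> \<alpha> b" for \<alpha>
    using b by (intro fibre_point_eqI) (auto simp: proj_frame)
  have "Q (snd t a) (snd t a) = (\<Sum>\<alpha>\<in>UNIV. (Q (snd t a) (snd t (\<sigma> \<alpha> b)))\<^sup>2)"
    by (rule orthonormal_expansion[OF bil]) (simp add: Q_def fps G_frame[OF b(2)])
  then show ?thesis
    by (simp add: Q_def fpa fps fibre_coord_def assms(2))
qed

text \<open>In another trivialisation, the section with constant components \<open>v\<close> is the transition matrix
  applied to \<open>v\<close>, so it is smooth.\<close>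

lemma smooth_fibre_point: "smooth_section A E (fst t) (\<lambda>b. fibre_point b v)"
  unfolding smooth_section_def
proof (intro conjI ballI)
  show "proj E (fibre_point b v) = b" if "b \<in> fst t" for b
    using that by (rule fibre_point)
  fix t' assume t': "t' \<in> trivs E"
  obtain M :: "'b \<Rightarrow> real^'m^'m" where M: "smooth_map A (fst t \<inter> fst t') M"
      "\<And>a. a \<in> proj E -` (fst t \<inter> fst t') \<Longrightarrow> snd t' a = M (proj E a) *v snd t a"
    using vbundle[unfolded vector_bundle_def, THEN conjunct2, THEN conjunct2, THEN conjunct2,
        THEN conjunct2, THEN conjunct2, THEN bspec, OF t, THEN bspec, OF t'] by blast
  show "smooth_map A (fst t \<inter> fst t') (snd t' \<circ> (\<lambda>b. fibre_point b v))"
    unfolding smooth_map_def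
  proof
    fix d assume d: "d \<in> A"
    then have "smooth_on (snd d ` (fst t \<inter> fst t' \<inter> fst d)) (M \<circ> chart_inv d)"
      using M(1) by (auto simp: smooth_map_def)
    from smooth_on_bounded_linear[OF bounded_linear_matrix_vector_mult[of v] this]
    show "smooth_on (snd d ` (fst t \<inter> fst t' \<inter> fst d)) (snd t' \<circ> (\<lambda>b. fibre_point b v) \<circ> chart_inv d)"
    proof (rule smooth_on_cong)
      fix z assume "z \<in> snd d ` (fst t \<inter> fst t' \<inter> fst d)"
      then obtain b where "z = snd d b" "b \<in> fst t \<inter> fst t' \<inter> fst d"
        by blast
      moreover have "is_chart d"
        using d atlas by (auto simp: smooth_atlas_def)
      ultimately have "chart_inv d z \<in> fst t \<inter> fst t'"
        using is_chartD(1)[of d b] by simp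
      then show "(M \<circ> chart_inv d) z *v v = (snd t' \<circ> (\<lambda>b. fibre_point b v) \<circ> chart_inv d) z"
        using M(2)[of "fibre_point (chart_inv d z) v"] by (simp add: fibre_point)
    qed
  qed
qed

text \<open>The frame coordinate \<open>x\<^sub>\<alpha>\<close> of the vector with components \<open>axis \<gamma> 1\<close> in the trivialisation.
  These are the coefficients of the linear change of fibre coordinates, as functions on the base.\<close>

definition coeff :: "'m \<Rightarrow> 'm \<Rightarrow> real^'n \<Rightarrow> real" where
  "coeff \<alpha> \<gamma> z = G (fibre_point (chart_inv c z) (axis \<gamma> 1)) (\<sigma> \<alpha> (chart_inv c z))"

lemma coeff_differentiable:
  assumes "z \<in> snd c ` V"
  shows "coeff \<alpha> \<gamma> differentiable (at z)"
proof -
  have "smooth_map A (U \<inter> fst t) (\<lambda>b. G (fibre_point b (axis \<gamma> 1)) (\<sigma> \<alpha> b))"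
    using fmetric smooth_section_subset[OF smooth_frame[of \<alpha>], of "U \<inter> fst t"]
      smooth_section_subset[OF smooth_fibre_point[of "axis \<gamma> 1"], of "U \<inter> fst t"] open_U triv(1)
    unfolding fibre_metric_def by blast
  then have "smooth_on (snd c ` (U \<inter> fst t \<inter> fst c)) ((\<lambda>b. G (fibre_point b (axis \<gamma> 1)) (\<sigma> \<alpha> b)) \<circ> chart_inv c)"
    using c by (auto simp: smooth_map_def)
  then have "smooth_on (snd c ` V) (coeff \<alpha> \<gamma>)"
    by (rule smooth_on_cong[OF smooth_on_subset]) (auto simp: coeff_def)
  then show ?thesis
    by (rule smooth_on_imp_differentiable) (use assms open_V in auto)
qed

definition x :: "'m \<Rightarrow> real^('n + 'm) \<Rightarrow> real" where
  "x \<alpha> y = fibre_coord E G \<sigma> \<alpha> (chart_inv C y)"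

text \<open>The differential of \<open>x\<^sub>\<alpha> = \<Sum>\<^sub>\<gamma> y\<^sub>\<gamma> coeff\<^sub>\<alpha>\<^sub>\<gamma>\<close> by the product rule. Written out, it shows how it
  scales in the fibres.\<close>

definition dx :: "'m \<Rightarrow> real^('n + 'm) \<Rightarrow> real^('n + 'm) \<Rightarrow> real" where
  "dx \<alpha> y w = (\<Sum>\<gamma>\<in>UNIV. fibre_part y $ \<gamma> * frechet_derivative (coeff \<alpha> \<gamma>) (at (base_part y)) (base_part w)
     + fibre_part w $ \<gamma> * coeff \<alpha> \<gamma> (base_part y))"

lemma x_eq:
  assumes "y \<in> dom"
  shows "x \<alpha> y = (\<Sum>\<gamma>\<in>UNIV. fibre_part y $ \<gamma> * coeff \<alpha> \<gamma> (base_part y))"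
proof -
  let ?b = "chart_inv c (base_part y)"
  have b: "?b \<in> fst t" "?b \<in> U"
    using C_inv[OF assms] by auto
  have lin: "linear (\<lambda>v. G (fibre_point ?b v) (\<sigma> \<alpha> ?b))"
    using b by (intro linear_G_fibre_point) (auto simp: proj_frame)
  have "x \<alpha> y = G (fibre_point ?b (\<Sum>\<gamma>\<in>UNIV. fibre_part y $ \<gamma> *\<^sub>R axis \<gamma> 1)) (\<sigma> \<alpha> ?b)"
    using basis_expansion[of "fibre_part y"] b
    by (simp add: scalar_mult_eq_scaleR x_def fibre_coord_def C_inv(2)[OF assms] fibre_point)
  then show ?thesis
    by (simp add: linear_sum[OF lin] linear_cmul[OF lin] coeff_def)
qed

lemma x_has_derivative:
  assumes "y \<in> dom"
  shows "(x \<alpha> has_derivative dx \<alpha> y) (at y)"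
proof -
  have "((\<lambda>z. coeff \<alpha> \<gamma> (base_part z)) has_derivative
      (\<lambda>w. frechet_derivative (coeff \<alpha> \<gamma>) (at (base_part y)) (base_part w))) (at y)" for \<gamma>
  proof -
    have "(coeff \<alpha> \<gamma> has_derivative frechet_derivative (coeff \<alpha> \<gamma>) (at (base_part y))) (at (base_part y))"
      using assms by (intro iffD1[OF frechet_derivative_works] coeff_differentiable) (simp add: dom_def)
    from has_derivative_compose[OF bounded_linear_imp_has_derivative[OF bounded_linear_base_part] this]
    show ?thesis .
  qed
  moreover have "((\<lambda>z. fibre_part z $ \<gamma>) has_derivative (\<lambda>w. fibre_part w $ \<gamma>)) (at y)" for \<gamma>
    by (rule bounded_linear_imp_has_derivative)
      (rule bounded_linear_compose[OF bounded_linear_vec_nth bounded_linear_fibre_part])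
  ultimately have "((\<lambda>z. \<Sum>\<gamma>\<in>UNIV. fibre_part z $ \<gamma> * coeff \<alpha> \<gamma> (base_part z)) has_derivative dx \<alpha> y) (at y)"
    unfolding dx_def[abs_def] by (intro has_derivative_sum has_derivative_mult)
  then show ?thesis
    by (rule has_derivative_transform_within_open[OF _ open_dom assms]) (simp add: x_eq)
qed

lemma linear_dx: "y \<in> dom \<Longrightarrow> linear (dx \<alpha> y)"
  using has_derivative_linear[OF x_has_derivative] .

lemma x_fibre_scale: "y \<in> dom \<Longrightarrow> x \<alpha> (fibre_scale l y) = l * x \<alpha> y"
  by (simp add: x_eq fibre_scale_in_dom sum_distrib_left mult.assoc)

lemma dx_fibre_scale: "dx \<alpha> (fibre_scale l y) (fibre_scale l w) = l * dx \<alpha> y w"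
  by (simp add: dx_def sum_distrib_left algebra_simps)

lemma dx_euler_field:
  assumes "y \<in> dom"
  shows "dx \<alpha> y (euler_field y) = x \<alpha> y"
proof -
  have "frechet_derivative (coeff \<alpha> \<gamma>) (at (base_part y)) 0 = 0" for \<gamma>
    using linear_0[OF linear_frechet_derivative[OF coeff_differentiable]] assms by (auto simp: dom_def)
  then show ?thesis
    by (simp add: dx_def x_eq[OF assms])
qed

subsection \<open>The connection forms\<close>

definition \<omega> :: "'m \<Rightarrow> 'm \<Rightarrow> real^('n + 'm) \<Rightarrow> real^('n + 'm) \<Rightarrow> real" where
  "\<omega> \<alpha> \<beta> y w = connection_form G D \<sigma> \<alpha> \<beta> c (chart_inv c (base_part y)) (base_part w)"

lemma proj_D:
  assumes "b \<in> U \<inter> fst c"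
  shows "proj E (D c b u (\<sigma> \<beta>)) = b"
proof -
  have "smooth_section A E (U \<inter> fst c) (\<lambda>b. D c b u (\<sigma> \<beta>))"
    using connection open_U smooth_frame c unfolding bundle_connection_def by blast
  then show ?thesis
    using assms by (auto simp: smooth_section_def)
qed

lemma linear_connection_form:
  assumes b: "b \<in> U \<inter> fst c"
  shows "linear (connection_form G D \<sigma> \<alpha> \<beta> c b)"
proof -
  note D = connection[unfolded bundle_connection_def, THEN spec, THEN spec, THEN mp,
      OF conjI[OF open_U smooth_frame[of \<beta>]], THEN conjunct2, THEN bspec, OF c, THEN bspec, OF b]
  have add: "D c b (u + v) (\<sigma> \<beta>) = vadd E (D c b u (\<sigma> \<beta>)) (D c b v (\<sigma> \<beta>))"
    and scale: "D c b (l *\<^sub>R u) (\<sigma> \<beta>) = vscale E l (D c b u (\<sigma> \<beta>))" for u v l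
      using D[THEN conjunct1] D[THEN conjunct2, THEN conjunct1] by simp_all
  show ?thesis
    using proj_D[OF b] proj_frame[of b] b
    by (intro linearI) (simp_all add: connection_form_def add scale G_vadd G_vscale)
qed

lemma linear_\<omega>: "y \<in> dom \<Longrightarrow> linear (\<omega> \<alpha> \<beta> y)"
  using linear_compose[OF bounded_linear.linear[OF bounded_linear_base_part] linear_connection_form]
    C_inv(1)[of y] by (auto simp: \<omega>_def[abs_def] o_def)

text \<open>Metric compatibility applied to the constant function \<open>G (\<sigma>\<^sub>\<beta>, \<sigma>\<^sub>\<alpha>)\<close>.\<close>

lemma \<omega>_antisym:
  assumes "y \<in> dom"
  shows "\<omega> \<alpha> \<beta> y w = - \<omega> \<beta> \<alpha> y w"
proof -
  let ?b = "chart_inv c (base_part y)" and ?u = "base_part w"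
  have b: "?b \<in> U \<inter> fst c" "?b \<in> U"
    using C_inv(1)[OF assms] by auto
  have sb: "base_part y \<in> snd c ` V"
    using assms by (simp add: dom_def)
  have "frechet_derivative ((\<lambda>b. G (\<sigma> \<beta> b) (\<sigma> \<alpha> b)) \<circ> chart_inv c) (at (base_part y)) =
      frechet_derivative (\<lambda>_. if \<beta> = \<alpha> then 1 else 0) (at (base_part y))"
  proof (rule frechet_derivative_cong_open[OF open_V(2) sb])
    fix z assume "z \<in> snd c ` V"
    then have "chart_inv c z \<in> U"
      using is_chartD(1)[OF chart] by auto
    then show "((\<lambda>b. G (\<sigma> \<beta> b) (\<sigma> \<alpha> b)) \<circ> chart_inv c) z = (if \<beta> = \<alpha> then 1 else 0)"
      by (simp add: G_frame)
  qed
  moreover have "snd c ?b = base_part y"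
    using sb is_chartD(2)[OF chart] by auto
  ultimately have "chart_deriv c (\<lambda>b. G (\<sigma> \<beta> b) (\<sigma> \<alpha> b)) ?b ?u = 0"
    by (simp add: chart_deriv_def)
  moreover have "chart_deriv c (\<lambda>b. G (\<sigma> \<beta> b) (\<sigma> \<alpha> b)) ?b ?u =
      G (D c ?b ?u (\<sigma> \<beta>)) (\<sigma> \<alpha> ?b) + G (\<sigma> \<beta> ?b) (D c ?b ?u (\<sigma> \<alpha>))"
    using compatible open_U smooth_frame c b(1) unfolding metric_compatible_def by blast
  ultimately show ?thesis
    using G_sym[of "\<sigma> \<beta> ?b" "D c ?b ?u (\<sigma> \<alpha>)"] proj_D[OF b(1)] proj_frame[OF b(2)]
    by (simp add: \<omega>_def connection_form_def)
qed

definition \<zeta> :: "'m \<Rightarrow> real^('n + 'm) \<Rightarrow> real^('n + 'm) \<Rightarrow> real" where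
  "\<zeta> \<alpha> y w = dx \<alpha> y w + (\<Sum>\<beta>\<in>UNIV. x \<beta> y * \<omega> \<alpha> \<beta> y w)"

lemma proj_deriv_eq:
  assumes "y \<in> dom"
  shows "proj_deriv E c t (chart_inv C y) w = base_part w"
proof -
  have "frechet_derivative (snd c \<circ> proj E \<circ> chart_inv C) (at y) = frechet_derivative base_part (at y)"
  proof (rule frechet_derivative_cong_open[OF open_dom assms])
    fix z assume "z \<in> dom"
    then show "(snd c \<circ> proj E \<circ> chart_inv C) z = base_part z"
      using C_inv(3)[of z] snd_C(1)[of "chart_inv C z"] by simp
  qed
  also have "\<dots> = base_part"
    using frechet_derivative_at[OF bounded_linear_imp_has_derivative[OF bounded_linear_base_part]] by metis
  finally show ?thesis
    by (simp add: proj_deriv_def chart_deriv_def C_inv(3)[OF assms])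
qed

lemma vertical_form_eq:
  assumes "y \<in> dom"
  shows "vertical_form E G D \<sigma> \<alpha> c t (chart_inv C y) w = \<zeta> \<alpha> y w"
proof -
  have "fibre_coord E G \<sigma> \<alpha> \<circ> chart_inv C = x \<alpha>"
    by (simp add: fun_eq_iff x_def)
  then have "chart_deriv C (fibre_coord E G \<sigma> \<alpha>) (chart_inv C y) w = dx \<alpha> y w"
    using frechet_derivative_at[OF x_has_derivative[OF assms], of \<alpha>]
    by (simp add: chart_deriv_def C_inv(3)[OF assms])
  then show ?thesis
    by (simp add: vertical_form_def \<zeta>_def proj_deriv_eq[OF assms] C_inv(5)[OF assms] \<omega>_def x_def)
qed

lemma linear_\<zeta>:
  assumes "y \<in> dom"
  shows "linear (\<zeta> \<alpha> y)"
  by (rule linearI) (simp_all add: \<zeta>_def linear_add[OF linear_dx[OF assms]] linear_cmul[OF linear_dx[OF assms]]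
      linear_add[OF linear_\<omega>[OF assms]] linear_cmul[OF linear_\<omega>[OF assms]]
      sum.distrib sum_distrib_left algebra_simps)

text \<open>Fibrewise scaling preserves the horizontal distribution because the connection is linear;
  the \<open>\<zeta>\<^sub>\<alpha>\<close> are homogeneous of degree one like the coordinates \<open>x\<^sub>\<alpha>\<close>.\<close>

lemma \<zeta>_fibre_scale:
  assumes "y \<in> dom"
  shows "\<zeta> \<alpha> (fibre_scale l y) (fibre_scale l w) = l * \<zeta> \<alpha> y w"
  by (simp add: \<zeta>_def dx_fibre_scale x_fibre_scale[OF assms] \<omega>_def sum_distrib_left algebra_simps)

lemma \<zeta>_euler_field:
  assumes "y \<in> dom"
  shows "\<zeta> \<alpha> y (euler_field y) = x \<alpha> y"
proof -
  have "\<omega> \<alpha> \<beta> y (euler_field y) = 0" for \<beta>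
    using linear_0[OF linear_connection_form[of "chart_inv c (base_part y)" \<alpha> \<beta>]] C_inv(1)[OF assms]
    by (simp add: \<omega>_def)
  then show ?thesis
    by (simp add: \<zeta>_def dx_euler_field[OF assms])
qed

text \<open>The connection terms \<open>x\<^sub>\<alpha> x\<^sub>\<beta> \<omega>\<^sub>\<alpha>\<^sub>\<beta>\<close> cancel by antisymmetry. Geometrically, parallel transport
  preserves the radius, so \<open>r dr\<close> vanishes on horizontal vectors.\<close>

lemma sum_x_\<zeta>:
  assumes "y \<in> dom"
  shows "(\<Sum>\<alpha>\<in>UNIV. x \<alpha> y * \<zeta> \<alpha> y w) = (\<Sum>\<alpha>\<in>UNIV. x \<alpha> y * dx \<alpha> y w)"
proof -
  let ?S = "\<Sum>\<alpha>\<in>UNIV. \<Sum>\<beta>\<in>UNIV. x \<alpha> y * (x \<beta> y * \<omega> \<alpha> \<beta> y w)"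
  have "?S = (\<Sum>\<alpha>\<in>UNIV. \<Sum>\<beta>\<in>UNIV. x \<beta> y * (x \<alpha> y * \<omega> \<beta> \<alpha> y w))"
    by (rule sum.swap)
  also have "\<dots> = - ?S"
    unfolding sum_negf[symmetric]
    by (intro sum.cong refl) (subst \<omega>_antisym[OF assms], simp)
  finally have "?S = 0"
    by simp
  then show ?thesis
    by (simp add: \<zeta>_def distrib_left sum.distrib sum_distrib_left)
qed

subsection \<open>The radius\<close>

definition \<rho> :: "real^('n + 'm) \<Rightarrow> real" where
  "\<rho> y = fibre_radius G (chart_inv C y)"

lemma \<rho>_eq:
  assumes "y \<in> dom"
  shows "\<rho> y = sqrt (\<Sum>\<alpha>\<in>UNIV. (x \<alpha> y)\<^sup>2)"
  using G_frame_expansion[OF _ C_inv(5)[OF assms]] C_inv(1)[OF assms]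
  by (simp add: \<rho>_def fibre_radius_def x_def)

lemma \<rho>_square: "y \<in> dom \<Longrightarrow> (\<rho> y)\<^sup>2 = (\<Sum>\<alpha>\<in>UNIV. (x \<alpha> y)\<^sup>2)"
  by (simp add: \<rho>_eq sum_nonneg)

lemma \<rho>_fibre_scale: "y \<in> dom \<Longrightarrow> l > 0 \<Longrightarrow> \<rho> (fibre_scale l y) = l * \<rho> y"
  by (simp add: \<rho>_eq fibre_scale_in_dom x_fibre_scale power_mult_distrib sum_distrib_left[symmetric] real_sqrt_mult)

lemma open_punctured: "open {y \<in> dom. \<rho> y > 0}"
proof -
  have "continuous_on dom (x \<alpha>)" for \<alpha>
    using x_has_derivative by (intro continuous_at_imp_continuous_on ballI has_derivative_continuous) blast
  then have "continuous_on dom (\<lambda>y. sqrt (\<Sum>\<alpha>\<in>UNIV. (x \<alpha> y)\<^sup>2))"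
    by (intro continuous_intros)
  then have "continuous_on dom \<rho>"
    by (rule continuous_on_eq) (simp add: \<rho>_eq)
  then have "open (\<rho> -` {0<..} \<inter> dom)"
    using open_dom by (simp add: continuous_on_open_vimage)
  moreover have "{y \<in> dom. \<rho> y > 0} = \<rho> -` {0<..} \<inter> dom"
    by auto
  ultimately show ?thesis
    by simp
qed

lemma \<rho>_has_derivative:
  assumes "y \<in> dom" "\<rho> y > 0"
  shows "(\<rho> has_derivative (\<lambda>w. (\<Sum>\<alpha>\<in>UNIV. x \<alpha> y * \<zeta> \<alpha> y w) / \<rho> y)) (at y)"
proof -
  let ?f = "\<lambda>z. \<Sum>\<alpha>\<in>UNIV. (x \<alpha> z)\<^sup>2"
  have f: "(?f has_derivative (\<lambda>w. \<Sum>\<alpha>\<in>UNIV. 2 * x \<alpha> y * dx \<alpha> y w)) (at y)"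
    by (rule has_derivative_eq_rhs) 
      (rule has_derivative_sum has_derivative_power x_has_derivative[OF assms(1)] | simp add: mult_ac)+
  have pos: "?f y > 0"
    using assms \<rho>_square by (metis zero_less_power)
  have "(sqrt has_derivative (*) (inverse (sqrt (?f y)) / 2)) (at (?f y))"
    using DERIV_real_sqrt[OF pos] by (simp add: has_field_derivative_def)
  from has_derivative_compose[OF f this]
  have "((\<lambda>z. sqrt (?f z)) has_derivative
      (\<lambda>w. inverse (\<rho> y) / 2 * (\<Sum>\<alpha>\<in>UNIV. 2 * x \<alpha> y * dx \<alpha> y w))) (at y)"
    by (simp only: \<rho>_eq[OF assms(1)])
  moreover have "inverse (\<rho> y) / 2 * (\<Sum>\<alpha>\<in>UNIV. 2 * x \<alpha> y * dx \<alpha> y w)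
      = (\<Sum>\<alpha>\<in>UNIV. x \<alpha> y * \<zeta> \<alpha> y w) / \<rho> y" for w
    unfolding sum_x_\<zeta>[OF assms(1)]
    by (simp add: sum_distrib_left sum_divide_distrib field_simps)
  ultimately have "((\<lambda>z. sqrt (?f z)) has_derivative (\<lambda>w. (\<Sum>\<alpha>\<in>UNIV. x \<alpha> y * \<zeta> \<alpha> y w) / \<rho> y)) (at y)"
    by simp
  then show ?thesis
    by (rule has_derivative_transform_within_open[OF _ open_dom assms(1)]) (simp add: \<rho>_eq)
qed

end

section \<open>The metric on the total space\<close>

lemma sum_UNIV_Plus:
  fixes f :: "'n::finite + 'm::finite \<Rightarrow> real"
  shows "(\<Sum>l\<in>UNIV. f l) = (\<Sum>i\<in>UNIV. f (Inl i)) + (\<Sum>\<alpha>\<in>UNIV. f (Inr \<alpha>))"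
  using sum.Plus[of "UNIV :: 'n set" "UNIV :: 'm set" f] by (simp add: UNIV_Plus_UNIV o_def)

text \<open>The metric \<open>h\<^sup>2 \<Sum> b\<^sub>i\<^sup>2 + k\<^sup>2 \<Sum> \<zeta>\<^sub>\<alpha>\<^sup>2\<close> over the domain of the frame, read in the one chart
  of the total space that the computation uses.\<close>

locale framed_bundle_metric = framed_bundle A E G D c t U \<sigma>
  for A :: "('b::topological_space, 'n::finite) chart set"
    and E :: "('b, 'e::topological_space, 'm::finite) vbundle"
    and G D c t U \<sigma> +
  fixes h k :: "real \<Rightarrow> real" and g :: "('e, 'n + 'm) metric"
    and \<beta> :: "'n \<Rightarrow> ('b, 'n) chart \<Rightarrow> 'b \<Rightarrow> real^'n"
  assumes total_metric: "\<And>a w w'. a \<in> proj E -` V \<Longrightarrow>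
           w \<bullet> (g C a *v w') =
             (h (fibre_radius G a))\<^sup>2 *
               (\<Sum>i\<in>UNIV. (\<beta> i c (proj E a) \<bullet> proj_deriv E c t a w) *
                            (\<beta> i c (proj E a) \<bullet> proj_deriv E c t a w')) +
             (k (fibre_radius G a))\<^sup>2 *
               (\<Sum>\<alpha>\<in>UNIV. vertical_form E G D \<sigma> \<alpha> c t a w * vertical_form E G D \<sigma> \<alpha> c t a w')"
begin

definition gm :: "real^('n + 'm) \<Rightarrow> real^('n + 'm)^('n + 'm)" where
  "gm y = g C (chart_inv C y)"

definition b :: "'n \<Rightarrow> real^('n + 'm) \<Rightarrow> real^('n + 'm) \<Rightarrow> real" where
  "b i y w = \<beta> i c (chart_inv c (base_part y)) \<bullet> base_part w"

lemma gm_eq: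
  assumes "y \<in> dom"
  shows "w \<bullet> (gm y *v w') = (h (\<rho> y))\<^sup>2 * (\<Sum>i\<in>UNIV. b i y w * b i y w')
    + (k (\<rho> y))\<^sup>2 * (\<Sum>\<alpha>\<in>UNIV. \<zeta> \<alpha> y w * \<zeta> \<alpha> y w')"
proof -
  have "chart_inv C y \<in> proj E -` V"
    using C_inv(1,5)[OF assms] by simp
  from total_metric[OF this] show ?thesis
    by (simp add: gm_def \<rho>_def b_def C_inv(5)[OF assms] proj_deriv_eq[OF assms] vertical_form_eq[OF assms])
qed

lemma linear_b: "linear (b i y)"
  by (rule linearI) (simp_all add: b_def linear_add[OF bounded_linear.linear[OF bounded_linear_base_part]]
      linear_cmul[OF bounded_linear.linear[OF bounded_linear_base_part]] inner_add_right)

lemma b_fibre_scale: "b i (fibre_scale l y) (fibre_scale l w) = b i y w"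
  by (simp add: b_def)

text \<open>The Euler field is vertical, and its vertical components are the coordinates \<open>x\<^sub>\<alpha>\<close>.\<close>

lemma gm_euler_field:
  assumes "y \<in> dom"
  shows "euler_field y \<bullet> (gm y *v w) = (k (\<rho> y))\<^sup>2 * (\<Sum>\<alpha>\<in>UNIV. x \<alpha> y * \<zeta> \<alpha> y w)"
  by (simp add: gm_eq[OF assms] \<zeta>_euler_field[OF assms]) (simp add: b_def)

lemma gm_euler_field_self:
  assumes "y \<in> dom"
  shows "euler_field y \<bullet> (gm y *v euler_field y) = (k (\<rho> y))\<^sup>2 * (\<rho> y)\<^sup>2"
  by (simp add: gm_euler_field[OF assms] \<zeta>_euler_field[OF assms] \<rho>_square[OF assms] power2_eq_square[of "x _ _"])

text \<open>The sum \<open>\<Sum>\<^sub>\<alpha> x\<^sub>\<alpha> \<zeta>\<^sub>\<alpha>\<close> is \<open>r dr\<close>, and \<open>k\<^sup>2\<close> times it is the 1-form dual to the Euler field.\<close>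

lemma \<rho>_gradient:
  assumes "y \<in> dom" "\<rho> y > 0" "k (\<rho> y) \<noteq> 0"
  shows "(\<rho> has_derivative (\<lambda>w. (euler_field y \<bullet> (gm y *v w)) / ((k (\<rho> y))\<^sup>2 * \<rho> y))) (at y)"
  using \<rho>_has_derivative[OF assms(1,2)] assms(3) by (simp add: gm_euler_field[OF assms(1)])

text \<open>The left-hand side is the Lie derivative of the metric along the Euler field, evaluated on
  \<open>u\<close> and \<open>v\<close>. It is the derivative at \<open>l = 1\<close> of the metric pulled back by scaling the fibres
  by \<open>l\<close>, and this pullback is \<open>h(l r)\<^sup>2 \<Sum> b\<^sub>i\<^sup>2 + l\<^sup>2 k(l r)\<^sup>2 \<Sum> \<zeta>\<^sub>\<alpha>\<^sup>2\<close>. The forms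
  themselves are evaluated only at \<open>y\<close>, so their derivatives do not appear.\<close>

lemma lie_derivative_euler_field:
  assumes y: "y \<in> dom" "\<rho> y > 0" and diff: "gm differentiable (at y)"
    and h: "(h has_real_derivative h1) (at (\<rho> y))" and k: "(k has_real_derivative k1) (at (\<rho> y))"
  shows "frechet_derivative (\<lambda>z. u \<bullet> (gm z *v v)) (at y) (euler_field y)
         + euler_field u \<bullet> (gm y *v v) + u \<bullet> (gm y *v euler_field v) =
      2 * h (\<rho> y) * h1 * \<rho> y * (\<Sum>i\<in>UNIV. b i y u * b i y v)
      + (2 * k (\<rho> y) * k1 * \<rho> y + 2 * (k (\<rho> y))\<^sup>2) * (\<Sum>\<alpha>\<in>UNIV. \<zeta> \<alpha> y u * \<zeta> \<alpha> y v)"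
proof -
  let ?B = "\<Sum>i\<in>UNIV. b i y u * b i y v" and ?Z = "\<Sum>\<alpha>\<in>UNIV. \<zeta> \<alpha> y u * \<zeta> \<alpha> y v"
  define \<Phi> where "\<Phi> l = fibre_scale l u \<bullet> (gm (fibre_scale l y) *v fibre_scale l v)" for l
  have \<Phi>: "\<Phi> l = (h (l * \<rho> y))\<^sup>2 * ?B + (l * k (l * \<rho> y))\<^sup>2 * ?Z" if "l > 0" for l
    using that
    by (simp add: \<Phi>_def gm_eq[OF fibre_scale_in_dom[OF y(1)]] \<rho>_fibre_scale[OF y(1)]
        b_fibre_scale \<zeta>_fibre_scale[OF y(1)] power_mult_distrib power2_eq_square sum_distrib_left mult_ac)
  have lin: "((\<lambda>l. l * \<rho> y) has_real_derivative \<rho> y) (at 1)"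
    by (auto intro!: derivative_eq_intros)
  have hl: "((\<lambda>l. h (l * \<rho> y)) has_real_derivative h1 * \<rho> y) (at 1)"
    using DERIV_chain'[OF lin, of h h1] h by simp
  have kl: "((\<lambda>l. k (l * \<rho> y)) has_real_derivative k1 * \<rho> y) (at 1)"
    using DERIV_chain'[OF lin, of k k1] k by simp
  have "((\<lambda>l. (h (l * \<rho> y))\<^sup>2 * ?B + (l * k (l * \<rho> y))\<^sup>2 * ?Z) has_real_derivative
      2 * h (\<rho> y) * h1 * \<rho> y * ?B + (2 * k (\<rho> y) * k1 * \<rho> y + 2 * (k (\<rho> y))\<^sup>2) * ?Z) (at 1)"
    by (rule derivative_eq_intros hl kl refl)+ (simp add: algebra_simps power2_eq_square)
  then have D1: "(\<Phi> has_real_derivative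
      2 * h (\<rho> y) * h1 * \<rho> y * ?B + (2 * k (\<rho> y) * k1 * \<rho> y + 2 * (k (\<rho> y))\<^sup>2) * ?Z) (at 1)"
    by (rule has_field_derivative_transform_within_open[of _ _ _ "{0<..}"]) (simp_all add: \<Phi>)
  obtain M' where M': "(gm has_derivative M') (at y)"
    using diff by (auto simp: differentiable_def)
  have one: "fibre_scale 1 z = z" for z :: "real^('n + 'm)"
    by (simp add: fibre_scale_def)
  have scale: "((\<lambda>l. fibre_scale l z) has_derivative (\<lambda>d. d *\<^sub>R euler_field z)) (at 1)" for z :: "real^('n + 'm)"
    unfolding fibre_scale_def by (auto intro!: derivative_eq_intros)
  have gml: "((\<lambda>l. gm (fibre_scale l y)) has_derivative (\<lambda>d. M' (d *\<^sub>R euler_field y))) (at 1)"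
    using has_derivative_compose[OF scale] M' by (simp add: one)
  have bil: "bounded_bilinear (\<lambda>(X :: real^('n + 'm)^('n + 'm)) v. X *v v)"
    by (auto intro!: bilinear_conv_bounded_bilinear[THEN iffD1] linearI
        simp: bilinear_def matrix_vector_mult_add_rdistrib matrix_vector_right_distrib
          scaleR_matrix_vector_assoc[symmetric] matrix_vector_mult_scaleR)
  have "(\<Phi> has_derivative (\<lambda>d. u \<bullet> (gm y *v (d *\<^sub>R euler_field v) + M' (d *\<^sub>R euler_field y) *v v)
      + (d *\<^sub>R euler_field u) \<bullet> (gm y *v v))) (at 1)"
    using has_derivative_inner[OF scale[of u] bounded_bilinear.FDERIV[OF bil gml scale[of v]]]
    by (simp add: \<Phi>_def[abs_def] one)
  moreover have "(\<Phi> has_derivative (\<lambda>d. d * (2 * h (\<rho> y) * h1 * \<rho> y * ?B + (2 * k (\<rho> y) * k1 * \<rho> y + 2 * (k (\<rho> y))\<^sup>2) * ?Z))) (at 1)"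
    using D1 by (simp add: has_field_derivative_def mult_commute_abs)
  ultimately have "(\<lambda>d. u \<bullet> (gm y *v (d *\<^sub>R euler_field v) + M' (d *\<^sub>R euler_field y) *v v)
      + (d *\<^sub>R euler_field u) \<bullet> (gm y *v v)) = (\<lambda>d. d * (2 * h (\<rho> y) * h1 * \<rho> y * ?B + (2 * k (\<rho> y) * k1 * \<rho> y + 2 * (k (\<rho> y))\<^sup>2) * ?Z))"
    by (rule has_derivative_unique)
  from fun_cong[OF this, of 1]
  have eq: "u \<bullet> (M' (euler_field y) *v v) + euler_field u \<bullet> (gm y *v v) + u \<bullet> (gm y *v euler_field v) =
      2 * h (\<rho> y) * h1 * \<rho> y * ?B + (2 * k (\<rho> y) * k1 * \<rho> y + 2 * (k (\<rho> y))\<^sup>2) * ?Z"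
    by (simp add: inner_add_right)
  from frechet_derivative_at[OF has_derivative_inner_right[OF
      bounded_linear.has_derivative[OF bounded_linear_matrix_vector_mult M']]]
  have "frechet_derivative (\<lambda>z. u \<bullet> (gm z *v v)) (at y) (euler_field y) = u \<bullet> (M' (euler_field y) *v v)"
    by metis
  with eq show ?thesis
    by simp
qed

text \<open>The \<open>b\<^sub>i\<close> and \<open>\<zeta>\<^sub>\<alpha>\<close> together diagonalise the metric, with weights \<open>h\<^sup>2\<close> and \<open>k\<^sup>2\<close>.\<close>

lemma trace_gm:
  assumes y: "y \<in> dom" and inv: "invertible (gm y)"
  shows "(\<Sum>p\<in>UNIV. \<Sum>q\<in>UNIV. matrix_inv (gm y) $ p $ q *
      (\<lambda>u v. \<mu> * (\<Sum>i\<in>UNIV. b i y u * b i y v) + \<nu> * (\<Sum>\<alpha>\<in>UNIV. \<zeta> \<alpha> y u * \<zeta> \<alpha> y v)) (axis p 1) (axis q 1))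
    = \<mu> * real CARD('n) / (h (\<rho> y))\<^sup>2 + \<nu> * real CARD('m) / (k (\<rho> y))\<^sup>2"
proof -
  define \<theta> where "\<theta> l = (case l of Inl i \<Rightarrow> b i y | Inr \<alpha> \<Rightarrow> \<zeta> \<alpha> y)" for l
  define a where "a l = (case l of Inl (i::'n) \<Rightarrow> (h (\<rho> y))\<^sup>2 | Inr (\<alpha>::'m) \<Rightarrow> (k (\<rho> y))\<^sup>2)" for l
  define \<kappa> where "\<kappa> l = (case l of Inl (i::'n) \<Rightarrow> \<mu> | Inr (\<alpha>::'m) \<Rightarrow> \<nu>)" for l
  let ?m = "matrix_inv (gm y)"
  have tr: "(\<Sum>p\<in>UNIV. \<Sum>q\<in>UNIV. ?m $ p $ q * (\<theta> l (axis p 1) * \<theta> l (axis q 1))) = 1 / a l" for l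
  proof (rule trace_diagonalised[OF inv])
    show "linear (\<theta> l)" for l
      by (auto simp: \<theta>_def linear_b linear_\<zeta>[OF y] split: sum.split)
    show "u \<bullet> (gm y *v v) = (\<Sum>l\<in>UNIV. a l * \<theta> l u * \<theta> l v)" for u v
      by (simp add: gm_eq[OF y] sum_UNIV_Plus a_def \<theta>_def sum_distrib_left mult.assoc)
  qed
  have "(\<Sum>p\<in>UNIV. \<Sum>q\<in>UNIV. ?m $ p $ q *
      (\<lambda>u v. \<mu> * (\<Sum>i\<in>UNIV. b i y u * b i y v) + \<nu> * (\<Sum>\<alpha>\<in>UNIV. \<zeta> \<alpha> y u * \<zeta> \<alpha> y v)) (axis p 1) (axis q 1))
    = (\<Sum>p\<in>UNIV. \<Sum>q\<in>UNIV. \<Sum>l\<in>UNIV. \<kappa> l * (?m $ p $ q * (\<theta> l (axis p 1) * \<theta> l (axis q 1))))"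
    by (simp add: sum_UNIV_Plus \<kappa>_def \<theta>_def sum_distrib_left distrib_left mult_ac)
  also have "\<dots> = (\<Sum>p\<in>UNIV. \<Sum>l\<in>UNIV. \<Sum>q\<in>UNIV. \<kappa> l * (?m $ p $ q * (\<theta> l (axis p 1) * \<theta> l (axis q 1))))"
    by (intro sum.cong refl sum.swap)
  also have "\<dots> = (\<Sum>l\<in>UNIV. \<Sum>p\<in>UNIV. \<Sum>q\<in>UNIV. \<kappa> l * (?m $ p $ q * (\<theta> l (axis p 1) * \<theta> l (axis q 1))))"
    by (rule sum.swap)
  also have "\<dots> = (\<Sum>l\<in>UNIV. \<kappa> l / a l)"
    by (simp add: sum_distrib_left[symmetric] tr)
  also have "\<dots> = \<mu> * real CARD('n) / (h (\<rho> y))\<^sup>2 + \<nu> * real CARD('m) / (k (\<rho> y))\<^sup>2"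
    by (simp add: sum_UNIV_Plus \<kappa>_def a_def mult.commute)
  finally show ?thesis .
qed

text \<open>The general Hessian formula with \<open>\<phi>(r) = k(r)\<^sup>2 r\<close>. The Euler field has squared length
  \<open>k\<^sup>2 r\<^sup>2\<close>, and the trace of half the Lie derivative of the metric along it is \<open>n r h' / h + m (r k' / k + 1)\<close>.\<close>

lemma laplacian_radial:
  fixes s s1 :: "real \<Rightarrow> real" and \<Gamma> :: "('e, 'n + 'm) christoffel"
  assumes e: "e \<in> fst C" "proj E e \<in> U" and r: "r = fibre_radius G e" "r > 0"
    and h: "(h has_real_derivative h1) (at r)"
    and k: "\<And>r. r > 0 \<Longrightarrow> k r \<noteq> 0" "(k has_real_derivative k1) (at r)"
    and s: "\<And>r. r > 0 \<Longrightarrow> (s has_real_derivative s1 r) (at r)"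
    and s1: "(s1 has_real_derivative s2) (at r)"
    and riem: "riemannian_metric_on (total_atlas A E) {e. fibre_radius G e > 0} g"
    and levi: "levi_civita_on (total_atlas A E) {e. fibre_radius G e > 0} g \<Gamma>"
    and "h r \<noteq> 0"
  shows "laplacian g \<Gamma> C (\<lambda>e. s (fibre_radius G e)) e =
           1 / (k r)\<^sup>2 * s2 +
           ((real CARD('m) - 1) / ((k r)\<^sup>2 * r) + real CARD('n) * h1 / (h r * (k r)\<^sup>2) +
            (real CARD('m) - 2) * k1 / (k r)^3) * s1 r"
proof -
  have C: "C \<in> total_atlas A E"
    using c t unfolding total_atlas_def by blast
  define y where "y = snd C e"
  have y: "y \<in> dom" and eJ: "chart_inv C y = e"
    using e by (simp_all add: y_def snd_C_in_dom C_inv_left)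
  have \<rho>y: "\<rho> y = r"
    by (simp add: \<rho>_def eJ r)
  define W where "W = {y \<in> dom. \<rho> y > 0}"
  have W: "open W" "y \<in> W"
    using open_punctured y \<rho>y r by (auto simp: W_def)
  have gmy: "gm y = g C e"
    by (simp add: gm_def eJ)
  have sub: "W \<subseteq> snd C ` ({e. fibre_radius G e > 0} \<inter> fst C)"
  proof
    fix z assume "z \<in> W"
    then show "z \<in> snd C ` ({e. fibre_radius G e > 0} \<inter> fst C)"
      using C_inv(3,4)[of z] by (intro image_eqI[of _ _ "chart_inv C z"]) (auto simp: W_def \<rho>_def)
  qed
  have "smooth_on (snd C ` ({e. fibre_radius G e > 0} \<inter> fst C)) (g C \<circ> chart_inv C)"
    using riem[unfolded riemannian_metric_on_def, THEN conjunct1] C by blast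
  moreover have "g C \<circ> chart_inv C = gm"
    by (simp add: fun_eq_iff gm_def)
  ultimately have diff: "gm differentiable (at y)"
    using smooth_on_imp_differentiable[OF _ W(1) sub W(2)] by simp
  have eW: "e \<in> {e. fibre_radius G e > 0} \<inter> fst C"
    using e r by simp
  note pd = riem[unfolded riemannian_metric_on_def, THEN conjunct2, THEN conjunct1, THEN bspec, OF C,
      THEN bspec, OF eW]
  have sym: "transpose (gm y) = gm y" and inv: "invertible (gm y)"
    using pd pos_def_imp_invertible by (auto simp: gmy)
  note lc = levi[unfolded levi_civita_on_def, THEN conjunct2]
  have torsion: "\<Gamma> C e u v = \<Gamma> C e v u" for u v
    using lc[THEN conjunct1] C eW by blast
  have compat: "frechet_derivative (\<lambda>z. v \<bullet> (gm z *v w)) (at y) u =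
      \<Gamma> C e u v \<bullet> (gm y *v w) + v \<bullet> (gm y *v \<Gamma> C e u w)" for u v w
    using lc[THEN conjunct2, THEN bspec, OF C, THEN bspec, OF eW, THEN spec, THEN spec, THEN spec, of v w u]
    by (simp add: chart_deriv_def o_def gm_def y_def[symmetric] eJ)
  let ?\<phi> = "\<lambda>r. (k r)\<^sup>2 * r"
  let ?\<phi>1 = "2 * k r * k1 * r + (k r)\<^sup>2"
  have \<phi>: "(?\<phi> has_real_derivative ?\<phi>1) (at (\<rho> y))"
    unfolding \<rho>y by (rule derivative_eq_intros k(2) refl)+ (simp add: algebra_simps)
  have k0: "k r \<noteq> 0"
    using k(1) r by blast
  have "laplacian g \<Gamma> C (\<lambda>e. s (fibre_radius G e)) e =
    (\<Sum>p\<in>UNIV. \<Sum>q\<in>UNIV. matrix_inv (gm y) $ p $ q *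
      (frechet_derivative (\<lambda>z. frechet_derivative (\<lambda>x. s (\<rho> x)) (at z) (axis q 1)) (at y) (axis p 1)
       - frechet_derivative (\<lambda>x. s (\<rho> x)) (at y) (\<Gamma> C e (axis p 1) (axis q 1))))"
  proof -
    have "frechet_derivative (\<lambda>z. frechet_derivative (\<lambda>x. s (\<rho> x)) (at (snd C (chart_inv C z))) v) (at y) =
      frechet_derivative (\<lambda>z. frechet_derivative (\<lambda>x. s (\<rho> x)) (at z) v) (at y)" for v
      by (rule frechet_derivative_cong_open[OF open_dom y]) (simp add: C_inv(3))
    then show ?thesis
      by (simp add: laplacian_def hessian_def cov_deriv_form_def chart_deriv_def o_def
          \<rho>_def[symmetric] y_def[symmetric] gmy)
  qed
  also have "\<dots> = (s2 - s1 (\<rho> y) * ?\<phi>1 / ?\<phi> (\<rho> y)) * (euler_field y \<bullet> (gm y *v euler_field y)) / (?\<phi> (\<rho> y))\<^sup>2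
    + s1 (\<rho> y) / ?\<phi> (\<rho> y) / 2 * (\<Sum>p\<in>UNIV. \<Sum>q\<in>UNIV. matrix_inv (gm y) $ p $ q *
        (frechet_derivative (\<lambda>z. axis p 1 \<bullet> (gm z *v axis q 1)) (at y) (euler_field y)
         + euler_field (axis p 1) \<bullet> (gm y *v axis q 1) + axis p 1 \<bullet> (gm y *v euler_field (axis q 1))))"
  proof (rule trace_hessian_radial[where \<Gamma> = "\<Gamma> C e" and \<rho> = \<rho> and \<phi> = ?\<phi> and W = W, OF W diff sym inv
        bounded_linear_euler_field _ _ _ \<phi> _ torsion compat])
    show "(\<rho> has_derivative (\<lambda>w. (euler_field z \<bullet> (gm z *v w)) / ?\<phi> (\<rho> z))) (at z)" if "z \<in> W" for z
      using that k(1) by (intro \<rho>_gradient) (auto simp: W_def)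
    show "(s has_real_derivative s1 (\<rho> z)) (at (\<rho> z))" if "z \<in> W" for z
      using that s by (auto simp: W_def)
    show "(s1 has_real_derivative s2) (at (\<rho> y))"
      using s1 \<rho>y by simp
    show "?\<phi> (\<rho> y) \<noteq> 0"
      using k0 r \<rho>y by simp
  qed
  also have "\<dots> = (s2 - s1 r * ?\<phi>1 / ?\<phi> r) * ((k r)\<^sup>2 * r\<^sup>2) / (?\<phi> r)\<^sup>2
    + s1 r / ?\<phi> r / 2 * (2 * h r * h1 * r * real CARD('n) / (h r)\<^sup>2
        + (2 * k r * k1 * r + 2 * (k r)\<^sup>2) * real CARD('m) / (k r)\<^sup>2)"
    using lie_derivative_euler_field[OF y _ diff, unfolded \<rho>y, OF r(2) h k(2)]
      trace_gm[OF y inv, unfolded \<rho>y, of "2 * h r * h1 * r" "2 * k r * k1 * r + 2 * (k r)\<^sup>2"]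
    by (simp only: gm_euler_field_self[OF y] \<rho>y)
  also have "\<dots> = 1 / (k r)\<^sup>2 * s2 +
           ((real CARD('m) - 1) / ((k r)\<^sup>2 * r) + real CARD('n) * h1 / (h r * (k r)\<^sup>2) +
            (real CARD('m) - 2) * k1 / (k r)^3) * s1 r"
    using k0 r(2) \<open>h r \<noteq> 0\<close> by (simp add: field_simps power2_eq_square power3_eq_cube)
  finally show ?thesis .
qed

end

section \<open>The Laplacian of a function of the radius\<close>

theorem corollary2p37:
  fixes A :: "('b::{t2_space, second_countable_topology}, 'n::finite) chart set"
    and gB :: "('b, 'n) metric"
    and E :: "('b, 'e::topological_space, 'm::finite) vbundle"
    and G :: "'e \<Rightarrow> 'e \<Rightarrow> real"
    and D :: "('b, 'n, 'e) connection"
    and h k s :: "real \<Rightarrow> real"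
    and g :: "('e, 'n + 'm) metric"
    and \<Gamma> :: "('e, 'n + 'm) christoffel"
    and C :: "('e, 'n + 'm) chart"
    and e :: 'e
    and r :: real
  assumes "smooth_atlas A" and "riemannian_metric_on A UNIV gB"
    and "vector_bundle A E" and "fibre_metric A E G"
    and "bundle_connection A E D" and "metric_compatible A E G D"
    and "smooth_on {0..} h" and "\<And>x. x \<ge> 0 \<Longrightarrow> h x > 0"
    and "smooth_on {0..} k" and "\<And>x. x \<ge> 0 \<Longrightarrow> k x > 0"
    and "is_total_metric A gB E G D h k g"
    and "riemannian_metric_on (total_atlas A E) {e. fibre_radius G e > 0} g"
    and "levi_civita_on (total_atlas A E) {e. fibre_radius G e > 0} g \<Gamma>"
    and "smooth_on {0<..} s"
    and "C \<in> total_atlas A E" and "e \<in> fst C" and "r = fibre_radius G e" and "r > 0"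
  shows "laplacian g \<Gamma> C (\<lambda>e. s (fibre_radius G e)) e =
           1 / (k r)\<^sup>2 * deriv (deriv s) r +
           ((real CARD('m) - 1) / ((k r)\<^sup>2 * r) +
            real CARD('n) * deriv h r / (h r * (k r)\<^sup>2) +
            (real CARD('m) - 2) * deriv k r / (k r)^3) * deriv s r"
proof -
  obtain c t where ct: "c \<in> A" "t \<in> trivs E" and C: "C = bundle_chart E c t"
    using assms(15) by (auto simp: total_atlas_def)
  obtain U \<beta> \<sigma> where U: "open U" "proj E e \<in> U" 
    and coframe: "orthonormal_coframe_on A gB U \<beta>" and frame: "orthonormal_frame_on A E G U \<sigma>"
    and metric: "\<forall>c\<in>A. \<forall>t\<in>trivs E. \<forall>e \<in> proj E -` (U \<inter> fst c \<inter> fst t). \<forall>w w'.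
           w \<bullet> (g (bundle_chart E c t) e *v w') =
             (h (fibre_radius G e))\<^sup>2 *
               (\<Sum>i\<in>UNIV. (\<beta> i c (proj E e) \<bullet> proj_deriv E c t e w) *
                            (\<beta> i c (proj E e) \<bullet> proj_deriv E c t e w')) +
             (k (fibre_radius G e))\<^sup>2 *
               (\<Sum>\<alpha>\<in>UNIV. vertical_form E G D \<sigma> \<alpha> c t e w * vertical_form E G D \<sigma> \<alpha> c t e w')"
    using assms(11)[unfolded is_total_metric_def, THEN spec, of "proj E e"]
    by (elim exE conjE) (rule that)
  interpret framed_bundle_metric A E G D c t U \<sigma> h k g \<beta>
    by unfold_locales
      (fact assms(1,3-6) ct U(1) frame
        metric[THEN bspec, OF ct(1), THEN bspec, OF ct(2), THEN bspec, THEN spec, THEN spec])+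
  have sub: "{0<..} \<subseteq> {0::real..}"
    by auto
  show ?thesis
    unfolding C
  proof (rule laplacian_radial[OF _ U(2) assms(17,18) _ _ _ _ _ assms(12,13)])
    show "e \<in> fst (bundle_chart E c t)"
      using assms(16) C by simp
    show "(h has_real_derivative deriv h r) (at r)"
      using assms(18) by (intro smooth_on_real_DERIV[OF assms(7) open_greaterThan sub]) simp
    show "(k has_real_derivative deriv k r) (at r)"
      using assms(18) by (intro smooth_on_real_DERIV[OF assms(9) open_greaterThan sub]) simp
    show "k x \<noteq> 0" if "x > 0" for x
      using assms(10)[of x] that by simp
    show "h r \<noteq> 0"
      using assms(8)[of r] assms(18) by simp
    show "(s has_real_derivative deriv s x) (at x)" if "x > 0" for x
      using that by (intro smooth_on_real_DERIV[OF assms(14) open_greaterThan]) auto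
    show "(deriv s has_real_derivative deriv (deriv s) r) (at r)"
      using assms(18) by (intro smooth_on_real_DERIV2[OF assms(14) open_greaterThan]) auto
  qed
qed

end
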